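(* In the setting of the context, there is a constant $C>0$ independent of $\varepsilon$ such that for all $0<\varepsilon\le\varepsilon_0$ and all $t\ge0$, $$ \begin{aligned} |\check z^\varepsilon_t-\tilde{\check z}^0_t|\le{}&\frac{e^{-\mu t}}{1-\Big(\frac{L}{\gamma_1-\mu}+\frac{\varepsilon L}{\mu-\varepsilon\gamma_2}\Big)}\Big(2|u_0-u|+2\frac{M_U}{\gamma_1}+\frac{M_V}{\gamma_2}\Big)\\ &+\frac{1-\frac{\varepsilon L}{\mu-\varepsilon\gamma_2}}{1-\Big(\frac{L}{\gamma_1-\mu}+\frac{\varepsilon L}{\mu-\varepsilon\gamma_2}\Big)}\,\frac{|Bv_0|+M_V}{\gamma_3}\big(1-e^{-\varepsilon\gamma_3t}\big)+C\beta(\varepsilon), \end{aligned} $$ where $u=\zeta(\omega_1)$ and $$ \beta(\varepsilon)=e^{\mu t_0}\Big(\frac{1}{\gamma_1-\varepsilon\gamma_2}e^{-\varepsilon\gamma_2t_0}-\frac1{\gamma_1}\Big)+\Big(\frac1{\gamma_1-\varepsilon\gamma_2}-\frac1{\gamma_1}\Big),\qquad t_0=\frac{1}{\varepsilon\gamma_2}\log\frac{(\mu-\varepsilon\gamma_2)\gamma_1}{(\gamma_1-\varepsilon\gamma_2)\mu}. $$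
   Context: **Noise.** Let $\alpha\in(1,2)$ and let $\check L^{\alpha\pm}=(\check L^{\alpha\pm}_t)_{t\in\mathbb{R}}$ be a two-sided $n$-dimensional symmetric $\alpha$-stable Lévy process: càdlàg, zero at time $0$, with stationary independent increments, and $\mathbb{E}e^{i\langle z,\check L^{\alpha\pm}_t\rangle}=\exp(-tC_1(n,\alpha)|z|^\alpha)$ for $t\ge0$, where $C_1(n,\alpha)=\pi^{-1/2}\Gamma((1+\alpha)/2)\Gamma(n/2)/\Gamma((n+\alpha)/2)$. (It arises as $\check L^{\alpha\pm}_t=\varepsilon^{-1/\alpha}L^{\alpha\pm}_{\varepsilon t}$ from a process of the same law.) It is realized canonically on $\Omega^1=D(\mathbb{R},\mathbb{R}^n)$ (càdlàg functions, Borel $\sigma$-algebra of the Skorohod topology), with its law $\mathbb{Q}^1$ and the shifts $\theta^1_t\omega_1(\cdot)=\omega_1(\cdot+t)-\omega_1(t)$. Only the component $\omega_1$ of $\omega$ is relevant here, and $\theta_t\omega$ acts on it as $\theta^1_t\omega_1$. **Coefficients and hypotheses.** $A\in\mathbb{R}^{n\times n}$, $B\in\mathbb{R}^{m\times m}$, $U:\mathbb{R}^n\times\mathbb{R}^m\to\mathbb{R}^n$, $V:\mathbb{R}^n\times\mathbb{R}^m\to\mathbb{R}^m$ Borel measurable, $\sigma_1\ne0$ real, $\varepsilon>0$. It is assumed that: (H1) there is $\gamma_1>0$ with $\langle Ax,x\rangle\le-\gamma_1|x|^2$ for all $x\in\mathbb{R}^n$; (H2) there are $\gamma_2,\gamma_3>0$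 with $\|e^{Bt}\|\le e^{-\gamma_2 t}$ for $t\le 0$ and $\|e^{Bt}\|\le e^{-\gamma_3 t}$ for $t>0$; (H3) there is $L>0$ such that $|U(x_1,y_1)-U(x_2,y_2)|\le L(|x_1-x_2|+|y_1-y_2|)$ and $|V(x_1,y_1)-V(x_2,y_2)|\le L(|x_1-x_2|+|y_1-y_2|)$ for all arguments; (H4) $\gamma_1>L$; (H5) $\sup|U|=M_U<\infty$ and $\sup|V|=M_V<\infty$. **Constants.** $\mu>0$ is a fixed constant with $\gamma_1-\mu>L$, and $\varepsilon_0>0$ is such that for all $0<\varepsilon\le\varepsilon_0$, $\mu-\varepsilon\gamma_2>0$ and $\frac{L}{\gamma_1-\mu}+\frac{\varepsilon L}{\mu-\varepsilon\gamma_2}<1$. On $\mathbb{R}^n\times\mathbb{R}^m$ the norm is $|(u,v)|=|u|+|v|$. **Stationary solution.** $\zeta:\Omega^1\to\mathbb{R}^n$ is a random vector which is a stationary solution of $d\zeta_t=A\zeta_t\,dt+\sigma_1\,d\check L^{\alpha\pm}_t$: for $\omega_1$ in a $\theta^1$-invariant set of full $\mathbb{Q}^1$-measure, the càdlàg function $t\mapsto\zeta(\theta^1_t\omega_1)$, $t\in\mathbb{R}$, solves this equation along $\omega_1$. All statements are for $\omega_1$ in this set. **Rescaled slow-fast system.** $\check z^\varepsilon_t=(\check u^\varepsilon_t,\check v^\varepsilon_t)$, $t\ge0$, is the solution of $$\dot{\check u}^\varepsilon=A\check u^\varepsilon+U(\check u^\varepsilon,\check v^\varepsilon)+\sigma_1\dot{\check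 L}^{\alpha\pm},\quad \dot{\check v}^\varepsilon=\varepsilon B\check v^\varepsilon+\varepsilon V(\check u^\varepsilon,\check v^\varepsilon),\qquad (\check u^\varepsilon_0,\check v^\varepsilon_0)=(u_0,v_0)\in\mathbb{R}^n\times\mathbb{R}^m.$$ **Reduced system for $\varepsilon=0$.** For $y\in\mathbb{R}^m$, let $(\hat{\check u}^0_t)_{t\le0}$ be the unique continuous solution of $\hat{\check u}^0_t=\int_{-\infty}^te^{A(t-r)}U(\hat{\check u}^0_r+\zeta(\theta^1_r\omega_1),y)\,dr$, $t\le0$, and put $$\check F^0(\omega,y)=\int_{-\infty}^0e^{-As}U(\hat{\check u}^0_s+\zeta(\theta^1_s\omega_1),y)\,ds=\hat{\check u}^0_0 .$$ The process $\tilde{\check z}^0_t=(\tilde{\check u}^0_t,\tilde{\check v}^0_t)$ is the solution of the reduced system $$\tilde{\check u}^0_t=\check F^0(\theta_t\omega,\tilde{\check v}^0_t)+\zeta(\theta^1_t\omega_1),\qquad d\tilde{\check v}^0_t=0,$$ with $\tilde{\check v}^0_0=v_0$; that is, $\tilde{\check z}^0_t=(\check F^0(\theta_t\omega,v_0)+\zeta(\theta^1_t\omega_1),\,v_0)$. *)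

theory Defs
  imports "HOL-Probability.Probability"
begin

definition mexp :: "real^'n^'n \<Rightarrow> real^'n^'n" where
  "mexp M = (\<Sum>k. (1 / fact k) *\<^sub>R ((\<lambda>X. M ** X) ^^ k) (mat 1))"

definition opnorm :: "real^'n^'n \<Rightarrow> real" where
  "opnorm M = onorm (\<lambda>x. M *v x)"

text \<open>The library norm on a product type is Euclidean; here the norm is \<open>|(u,v)| = |u| + |v|\<close>.\<close>

definition sum_norm :: "'a::real_normed_vector \<times> 'b::real_normed_vector \<Rightarrow> real" where
  "sum_norm z = norm (fst z) + norm (snd z)"

definition cadlag :: "(real \<Rightarrow> 'a::topological_space) \<Rightarrow> bool" where
  "cadlag x \<longleftrightarrow> (\<forall>t. (x \<longlongrightarrow> x t) (at_right t) \<and> (\<exists>l. (x \<longlongrightarrow> l) (at_left t)))"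

definition skorohod_space :: "(real \<Rightarrow> 'a::real_normed_vector) set" where
  "skorohod_space = {x. cadlag x}"

text \<open>The cut-off \<open>cutoff m x\<close> is \<open>x\<close> multiplied by the piecewise linear function that is \<open>1\<close> for
  \<open>|t| \<le> m - 1\<close> and \<open>0\<close> for \<open>|t| \<ge> m\<close>.\<close>

definition cutoff :: "nat \<Rightarrow> (real \<Rightarrow> 'a::real_normed_vector) \<Rightarrow> real \<Rightarrow> 'a" where
  "cutoff m x t = max 0 (min 1 (real m - \<bar>t\<bar>)) *\<^sub>R x t"

text \<open>Increasing bijections of \<open>[-m, m]\<close>; these are automatically homeomorphisms.\<close>

definition time_changes :: "nat \<Rightarrow> (real \<Rightarrow> real) set" where
  "time_changes m = {\<rho>. strict_mono_on {- real m..real m} \<rho> \<and>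
     \<rho> ` {- real m..real m} = {- real m..real m}}"

text \<open>Billingsley's complete metric for the J1 topology on \<open>[-m, m]\<close>: the infimum over time
  changes \<open>\<rho>\<close> of the maximum of \<open>sup |x(t) - y(\<rho> t)|\<close> and \<open>sup |log ((\<rho> t - \<rho> s) / (t - s))|\<close>.\<close>

definition skorohod_dist_on ::
  "nat \<Rightarrow> (real \<Rightarrow> 'a::real_normed_vector) \<Rightarrow> (real \<Rightarrow> 'a) \<Rightarrow> real" where
  "skorohod_dist_on m x y = Inf {e. \<exists>\<rho>\<in>time_changes m.
     (\<forall>t\<in>{- real m..real m}. norm (x t - y (\<rho> t)) \<le> e) \<and>
     (\<forall>s\<in>{- real m..real m}. \<forall>t\<in>{- real m..real m}. s < t \<longrightarrow>
        \<bar>ln ((\<rho> t - \<rho> s) / (t - s))\<bar> \<le> e)}"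

definition skorohod_dist ::
  "(real \<Rightarrow> 'a::real_normed_vector) \<Rightarrow> (real \<Rightarrow> 'a) \<Rightarrow> real" where
  "skorohod_dist x y = (\<Sum>k. (1 / 2 ^ Suc k) *
     min 1 (skorohod_dist_on (Suc k) (cutoff (Suc k) x) (cutoff (Suc k) y)))"

definition skorohod_open :: "(real \<Rightarrow> 'a::real_normed_vector) set \<Rightarrow> bool" where
  "skorohod_open G \<longleftrightarrow> G \<subseteq> skorohod_space \<and>
     (\<forall>x\<in>G. \<exists>e>0. \<forall>y\<in>skorohod_space. skorohod_dist x y < e \<longrightarrow> y \<in> G)"

definition skorohod_borel :: "(real \<Rightarrow> 'a::real_normed_vector) measure" where
  "skorohod_borel = sigma skorohod_space {G. skorohod_open G}"

definition path_shift :: "real \<Rightarrow> (real \<Rightarrow> 'a::real_normed_vector) \<Rightarrow> real \<Rightarrow> 'a" where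
  "path_shift t \<omega> = (\<lambda>s. \<omega> (s + t) - \<omega> t)"

definition stable_const :: "nat \<Rightarrow> real \<Rightarrow> real" where
  "stable_const n \<alpha> = pi powr (- 1 / 2) * Gamma ((1 + \<alpha>) / 2) * Gamma (real n / 2)
     / Gamma ((real n + \<alpha>) / 2)"

text \<open>\<open>Q\<close> is the law on path space of the two-sided symmetric stable process; the process itself is
  the coordinate process \<open>\<omega> \<mapsto> \<omega> t\<close>.\<close>

definition stable_levy_law :: "real \<Rightarrow> (real \<Rightarrow> real^'n) measure \<Rightarrow> bool" where
  "stable_levy_law \<alpha> Q \<longleftrightarrow>
     prob_space Q \<and> space Q = skorohod_space \<and> sets Q = sets skorohod_borel \<and>
     (AE \<omega> in Q. \<omega> 0 = 0) \<and>
     (\<forall>s t h. s \<le> t \<longrightarrow>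
        distr Q borel (\<lambda>\<omega>. \<omega> (t + h) - \<omega> (s + h)) = distr Q borel (\<lambda>\<omega>. \<omega> t - \<omega> s)) \<and>
     (\<forall>(k::nat) \<tau>. (\<forall>i<k. \<tau> i \<le> \<tau> (Suc i)) \<longrightarrow>
        prob_space.indep_vars Q (\<lambda>_. borel) (\<lambda>i \<omega>. \<omega> (\<tau> (Suc i)) - \<omega> (\<tau> i)) {..<k}) \<and>
     (\<forall>t\<ge>0. \<forall>z. (CLINT \<omega>|Q. iexp (z \<bullet> \<omega> t)) =
        complex_of_real (exp (- t * stable_const CARD('n) \<alpha> * norm z powr \<alpha>)))"

text \<open>Invariance is required as equality \<open>\<theta>\<^sub>t \<Omega>' = \<Omega>'\<close>. For \<open>t = 0\<close> this forces \<open>\<omega> 0 = 0\<close> on the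
  invariant set, so that the shifts act there as a flow. The stochastic equation has additive
  noise and is understood path by path in integrated form.\<close>

definition stationary_solution ::
  "real^'n^'n \<Rightarrow> real \<Rightarrow> (real \<Rightarrow> real^'n) measure \<Rightarrow> ((real \<Rightarrow> real^'n) \<Rightarrow> real^'n)
     \<Rightarrow> (real \<Rightarrow> real^'n) set \<Rightarrow> bool" where
  "stationary_solution A \<sigma> Q \<zeta> \<Omega>' \<longleftrightarrow>
     \<zeta> \<in> borel_measurable Q \<and>
     \<Omega>' \<subseteq> space Q \<and> (AE \<omega> in Q. \<omega> \<in> \<Omega>') \<and> (\<forall>t. path_shift t ` \<Omega>' = \<Omega>') \<and>
     (\<forall>\<omega>\<in>\<Omega>'. cadlag (\<lambda>t. \<zeta> (path_shift t \<omega>)) \<and>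
        (\<forall>s t. s \<le> t \<longrightarrow>
           ((\<lambda>r. A *v \<zeta> (path_shift r \<omega>)) has_integral
              (\<zeta> (path_shift t \<omega>) - \<zeta> (path_shift s \<omega>) - \<sigma> *\<^sub>R (\<omega> t - \<omega> s))) {s..t}))"

text \<open>Pathwise solution on \<open>[0, \<infinity>)\<close> along \<open>\<omega>\<close>, again in integrated form. The driving path starts at
  \<open>\<omega> 0 = 0\<close> for the paths considered.\<close>

definition rescaled_solution ::
  "real^'n^'n \<Rightarrow> real^'m^'m \<Rightarrow> (real^'n \<Rightarrow> real^'m \<Rightarrow> real^'n) \<Rightarrow> (real^'n \<Rightarrow> real^'m \<Rightarrow> real^'m)
     \<Rightarrow> real \<Rightarrow> real \<Rightarrow> (real \<Rightarrow> real^'n) \<Rightarrow> (real^'n) \<times> (real^'m) \<Rightarrow> (real \<Rightarrow> (real^'n) \<times> (real^'m)) \<Rightarrow> bool"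
  where
  "rescaled_solution A B U V \<sigma> \<epsilon> \<omega> z0 z \<longleftrightarrow>
     (\<forall>t\<ge>0.
        ((\<lambda>s. A *v fst (z s) + U (fst (z s)) (snd (z s))) has_integral
           (fst (z t) - fst z0 - \<sigma> *\<^sub>R \<omega> t)) {0..t} \<and>
        ((\<lambda>s. \<epsilon> *\<^sub>R (B *v snd (z s)) + \<epsilon> *\<^sub>R V (fst (z s)) (snd (z s))) has_integral
           (snd (z t) - snd z0)) {0..t})"

text \<open>The continuous solution, on \<open>t \<le> 0\<close>, of the integral equation with frozen slow variable \<open>y\<close>.
  Its values for \<open>t > 0\<close> are unconstrained and never used.\<close>

definition frozen_solution ::
  "real^'n^'n \<Rightarrow> (real^'n \<Rightarrow> real^'m \<Rightarrow> real^'n) \<Rightarrow> ((real \<Rightarrow> real^'n) \<Rightarrow> real^'n)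
     \<Rightarrow> (real \<Rightarrow> real^'n) \<Rightarrow> real^'m \<Rightarrow> (real \<Rightarrow> real^'n) \<Rightarrow> bool" where
  "frozen_solution A U \<zeta> \<omega> y w \<longleftrightarrow>
     continuous_on {..0} w \<and>
     (\<forall>t\<le>0. ((\<lambda>r. mexp ((t - r) *\<^sub>R A) *v U (w r + \<zeta> (path_shift r \<omega>)) y) has_integral w t) {..t})"

definition critical_F ::
  "real^'n^'n \<Rightarrow> (real^'n \<Rightarrow> real^'m \<Rightarrow> real^'n) \<Rightarrow> ((real \<Rightarrow> real^'n) \<Rightarrow> real^'n)
     \<Rightarrow> (real \<Rightarrow> real^'n) \<Rightarrow> real^'m \<Rightarrow> real^'n" where
  "critical_F A U \<zeta> \<omega> y =
     (let w = (SOME w. frozen_solution A U \<zeta> \<omega> y w)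
      in integral {..0} (\<lambda>s. mexp (- s *\<^sub>R A) *v U (w s + \<zeta> (path_shift s \<omega>)) y))"

definition reduced_process ::
  "real^'n^'n \<Rightarrow> (real^'n \<Rightarrow> real^'m \<Rightarrow> real^'n) \<Rightarrow> ((real \<Rightarrow> real^'n) \<Rightarrow> real^'n)
     \<Rightarrow> (real \<Rightarrow> real^'n) \<Rightarrow> real^'m \<Rightarrow> real \<Rightarrow> (real^'n) \<times> (real^'m)" where
  "reduced_process A U \<zeta> \<omega> v0 t =
     (critical_F A U \<zeta> (path_shift t \<omega>) v0 + \<zeta> (path_shift t \<omega>), v0)"

definition err_t0 :: "real \<Rightarrow> real \<Rightarrow> real \<Rightarrow> real \<Rightarrow> real" where
  "err_t0 \<gamma>1 \<gamma>2 \<mu> \<epsilon> =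
     1 / (\<epsilon> * \<gamma>2) * ln (((\<mu> - \<epsilon> * \<gamma>2) * \<gamma>1) / ((\<gamma>1 - \<epsilon> * \<gamma>2) * \<mu>))"

definition err_beta :: "real \<Rightarrow> real \<Rightarrow> real \<Rightarrow> real \<Rightarrow> real" where
  "err_beta \<gamma>1 \<gamma>2 \<mu> \<epsilon> =
     exp (\<mu> * err_t0 \<gamma>1 \<gamma>2 \<mu> \<epsilon>) *
       (1 / (\<gamma>1 - \<epsilon> * \<gamma>2) * exp (- \<epsilon> * \<gamma>2 * err_t0 \<gamma>1 \<gamma>2 \<mu> \<epsilon>) - 1 / \<gamma>1)
     + (1 / (\<gamma>1 - \<epsilon> * \<gamma>2) - 1 / \<gamma>1)"

end

theory Submission
  imports Defs
begin

text \<open>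
  Subtracting the stationary solution turns the fast equation into \<open>x' = A x + U (x + p, v)\<close>, where
  \<open>p r = \<zeta> (path_shift r \<omega>)\<close> is right-continuous and \<open>x 0 = u0 - \<zeta> \<omega>\<close>. The bound on \<open>exp (t B)\<close> for
  positive \<open>t\<close> makes \<open>B\<close> dissipative with rate \<open>\<gamma>3\<close> (\<open>dissipative_if_exp_bound\<close>), so the slow variable
  satisfies
  \<open>norm (v s - v0) \<le> D s = (norm (B v0) + MV) / \<gamma>3 * (1 - exp (- \<epsilon> \<gamma>3 s))\<close>.

  Fix \<open>t\<close>. The reduced fast variable at time \<open>t\<close> is \<open>p t\<close> plus the endpoint \<open>w 0\<close> of a trajectory that
  solves \<open>w' = A w + U (w + p (_ + t), v0)\<close> on the negative half-line and is bounded by \<open>MU / \<gamma>1\<close>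
  (\<open>critical_F_trajectory\<close>). Such a trajectory exists by Banach's fixed point theorem, as
  \<open>L < \<gamma>1\<close>. Comparing \<open>x r\<close> with \<open>w (r - t)\<close> on \<open>{0..t}\<close>, dissipativity of \<open>A\<close> and the Lipschitz bound
  give
  \<open>norm (x t - w 0) \<le> exp (- (\<gamma>1 - L) t) * (norm (u0 - \<zeta> \<omega>) + MU / \<gamma>1) + L / (\<gamma>1 - L) * D t\<close>.
  Here \<open>\<mu> < \<gamma>1 - L\<close>, the factor \<open>1 + L / (\<gamma>1 - L)\<close> of \<open>D t\<close> in the sum of both errors is at most the
  stated coefficient (\<open>slow_coefficient_le\<close>), and \<open>err_beta\<close> is nonnegative (\<open>err_beta_nonneg\<close>).

  The paths jump, so all differential equations are read with right derivatives. Both comparisons,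
  and the decay and semigroup law of the matrix exponential, come from one Gronwall inequality for
  right derivatives (\<open>norm_le_comparison\<close>).
\<close>

section \<open>Right derivatives and dissipative comparison\<close>

lemma nonpos_if_right_derivative_negative:
  fixes f :: "real \<Rightarrow> real"
  assumes "a \<le> b" and cont: "continuous_on {a..b} f" and fa: "f a \<le> 0"
    and deriv: "\<And>t. a \<le> t \<Longrightarrow> t < b \<Longrightarrow> f t > 0 \<Longrightarrow>
      \<exists>D<0. (f has_real_derivative D) (at_right t)"
  shows "f b \<le> 0"
proof (rule ccontr)
  assume "\<not> f b \<le> 0"
  then have fb: "f b > 0" by simp
  \<comment> \<open>At the last time \<open>q\<close> where \<open>f \<le> c\<close>, the function would have to decrease to the right.\<close>
  define c where "c = f b / 2"
  have c: "0 < c" "c < f b" using fb by (auto simp: c_def)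
  define S where "S = {t \<in> {a..b}. f t \<le> c}"
  have "closed S"
    using continuous_closed_preimage[OF cont, of "{..c}"]
    by (simp add: S_def vimage_def Int_def)
  have "a \<in> S" using assms(1) fa c by (auto simp: S_def)
  have bdd: "bdd_above S" by (auto simp: S_def)
  define q where "q = Sup S"
  have "q \<in> S" unfolding q_def
    using \<open>closed S\<close> \<open>a \<in> S\<close> bdd by (intro closed_contains_Sup) auto
  then have q: "a \<le> q" "q \<le> b" "f q \<le> c" by (auto simp: S_def)
  with c have "q < b" by (cases "q = b") auto
  have above: "f t > c" if "q < t" "t \<le> b" for t
  proof (rule ccontr)
    assume "\<not> f t > c"
    then have "t \<in> S" using that q by (auto simp: S_def)
    then have "t \<le> q" unfolding q_def by (intro cSup_upper bdd)
    with that show False by simp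
  qed
  have "(f \<longlongrightarrow> f q) (at q within {a..b})"
    using cont q by (auto simp: continuous_on_def)
  then have "(f \<longlongrightarrow> f q) (at q within {q..b})"
    by (rule tendsto_within_subset) (use q in auto)
  then have "(f \<longlongrightarrow> f q) (at_right q)"
    using \<open>q < b\<close> by (simp add: at_within_Icc_at_right)
  moreover have "\<forall>\<^sub>F t in at_right q. c \<le> f t"
    using \<open>q < b\<close> above by (intro eventually_at_rightI[of q b]) (auto intro: less_imp_le)
  ultimately have "c \<le> f q"
    by (intro tendsto_lowerbound[of f "f q" "at_right q"]) auto
  with q c have "f q = c" "f q > 0" by auto
  from deriv[OF q(1) \<open>q < b\<close> this(2)] obtain D where
    "D < 0" "(f has_real_derivative D) (at_right q)" by auto
  from has_real_derivative_neg_dec_right[OF this(2,1)] obtain \<delta> where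
    \<delta>: "\<delta> > 0" "\<And>h. 0 < h \<Longrightarrow> q + h \<in> {q<..} \<Longrightarrow> h < \<delta> \<Longrightarrow> f (q + h) < f q" by auto
  define h where "h = min (\<delta> / 2) (b - q)"
  have "0 < h" "h < \<delta>" "q + h \<le> b" using \<delta>(1) \<open>q < b\<close> by (auto simp: h_def)
  then show False using \<delta>(2)[of h] above[of "q + h"] \<open>f q = c\<close> by auto
qed

text \<open>
  A matrix \<open>A\<close> is dissipative with rate \<open>\<gamma> > 0\<close> when its symmetric part is at most \<open>- \<gamma>\<close>. This is the
  only property of the two drift matrices that the estimates use.
\<close>

locale dissipative =
  fixes A :: "real^'n^'n" and \<gamma> :: real
  assumes rate_pos: "\<gamma> > 0"
    and dissipative: "(A *v x) \<bullet> x \<le> - \<gamma> * (norm x)\<^sup>2"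
begin

text \<open>
  A Gronwall inequality for a curve that is differentiable only from the right. The bound solves
  \<open>\<psi>' = - (\<gamma> - l) \<psi> + R\<close> with \<open>\<psi> 0 = norm (d 0)\<close>. Where \<open>norm (d t) > \<psi> t\<close> the curve is not zero, so
  its norm is differentiable there and \<open>norm (d t) - \<psi> t\<close> has a negative right derivative.
\<close>

lemma norm_le_comparison:
  fixes d h :: "real \<Rightarrow> real^'n"
  assumes T: "0 \<le> T" and cont: "continuous_on {0..T} d"
    and deriv: "\<And>t. 0 \<le> t \<Longrightarrow> t < T \<Longrightarrow>
      (d has_vector_derivative (A *v d t + h t)) (at_right t)"
    and bound: "\<And>t. 0 \<le> t \<Longrightarrow> t < T \<Longrightarrow> norm (h t) \<le> l * norm (d t) + R"
    and l: "l < \<gamma>" and R: "0 \<le> R"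
  shows "norm (d T) \<le> exp (- (\<gamma> - l) * T) * norm (d 0) + R / (\<gamma> - l) * (1 - exp (- (\<gamma> - l) * T))"
proof -
  define \<psi> where "\<psi> = (\<lambda>t. exp (- (\<gamma> - l) * t) * norm (d 0)
    + R / (\<gamma> - l) * (1 - exp (- (\<gamma> - l) * t)))"
  have \<psi>_deriv: "(\<psi> has_real_derivative (- (\<gamma> - l) * \<psi> t + R)) (at t within S)" for t S
  proof -
    define \<kappa> where "\<kappa> = \<gamma> - l"
    have "\<kappa> \<noteq> 0" using l by (simp add: \<kappa>_def)
    then show ?thesis
      unfolding \<psi>_def \<kappa>_def[symmetric]
      by (auto intro!: derivative_eq_intros simp: algebra_simps)
  qed
  have \<psi>_nonneg: "\<psi> t \<ge> 0" if "t \<ge> 0" for t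
    unfolding \<psi>_def using that l R 
    by (intro add_nonneg_nonneg mult_nonneg_nonneg) (auto simp: mult_nonpos_nonneg)
  have "norm (d T) - \<psi> T \<le> 0"
  proof (rule nonpos_if_right_derivative_negative[OF T])
    show "continuous_on {0..T} (\<lambda>t. norm (d t) - \<psi> t)"
      by (intro continuous_intros cont DERIV_continuous_on[OF \<psi>_deriv])
    show "norm (d 0) - \<psi> 0 \<le> 0" by (simp add: \<psi>_def)
    fix t assume t: "0 \<le> t" "t < T" "0 < norm (d t) - \<psi> t"
    let ?v = "A *v d t + h t"
    have ne: "d t \<noteq> 0" using t \<psi>_nonneg[of t] by auto
    have "((\<lambda>s. norm (d s)) has_vector_derivative ?v \<bullet> sgn (d t)) (at_right t)"
      using has_derivative_compose[OF deriv[OF t(1,2), unfolded has_vector_derivative_def]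
          has_derivative_norm[OF ne]]
      by (simp add: has_vector_derivative_def)
    then have "((\<lambda>s. norm (d s)) has_real_derivative ?v \<bullet> sgn (d t)) (at_right t)"
      by (simp add: has_real_derivative_iff_has_vector_derivative)
    from DERIV_diff[OF this \<psi>_deriv]
    have D: "((\<lambda>s. norm (d s) - \<psi> s) has_real_derivative
      (?v \<bullet> sgn (d t) - (- (\<gamma> - l) * \<psi> t + R))) (at_right t)" .
    have "(A *v d t) \<bullet> sgn (d t) = ((A *v d t) \<bullet> d t) / norm (d t)"
      by (simp add: sgn_div_norm divide_inverse_commute)
    also have "\<dots> \<le> (- \<gamma> * (norm (d t))\<^sup>2) / norm (d t)"
      by (intro divide_right_mono dissipative) simp
    also have "\<dots> = - \<gamma> * norm (d t)" using ne by (simp add: power2_eq_square)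
    finally have 1: "(A *v d t) \<bullet> sgn (d t) \<le> - \<gamma> * norm (d t)" .
    have "h t \<bullet> sgn (d t) \<le> norm (h t) * norm (sgn (d t))" by (rule norm_cauchy_schwarz)
    also have "\<dots> = norm (h t)" using ne by (simp add: norm_sgn)
    also have "\<dots> \<le> l * norm (d t) + R" by (rule bound[OF t(1,2)])
    finally have "?v \<bullet> sgn (d t) - (- (\<gamma> - l) * \<psi> t + R) \<le> - (\<gamma> - l) * (norm (d t) - \<psi> t)"
      using 1 by (simp add: inner_add_left algebra_simps)
    also have "\<dots> < 0" using t(3) l by (simp add: mult_neg_pos)
    finally show "\<exists>D<0. ((\<lambda>s. norm (d s) - \<psi> s) has_real_derivative D) (at_right t)"
      using D by blast
  qed
  then show ?thesis by (simp add: \<psi>_def)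
qed

end

section \<open>The matrix exponential\<close>

text \<open>Each coordinate is a scalar power series with infinite radius of convergence.\<close>

lemma has_vector_derivative_exp_series:
  fixes T :: "'a::euclidean_space \<Rightarrow> 'a"
  assumes T: "bounded_linear T"
  defines "E \<equiv> \<lambda>t x. \<Sum>k. (t ^ k / fact k) *\<^sub>R (T ^^ k) x"
  shows "((\<lambda>t. E t x) has_vector_derivative T (E t x)) (at t)"
proof -
  obtain K where K: "K > 0" "\<And>x. norm (T x) \<le> norm x * K"
    using bounded_linear.pos_bounded[OF T] by blast
  have power_bound: "norm ((T ^^ k) x) \<le> K ^ k * norm x" for k x
  proof (induction k)
    case (Suc k)
    have "norm ((T ^^ Suc k) x) \<le> norm ((T ^^ k) x) * K" using K(2) by simp
    also have "\<dots> \<le> (K ^ k * norm x) * K" using Suc K(1) by (intro mult_right_mono) auto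
    finally show ?case by (simp add: mult_ac)
  qed simp
  have summable_exp: "summable (\<lambda>k. (\<bar>t\<bar> * K) ^ k / fact k * norm x)" for t and x :: 'a
    by (intro summable_mult2) (use summable_exp[of "\<bar>t\<bar> * K"] in \<open>simp add: divide_inverse_commute\<close>)
  have sm: "summable (\<lambda>k. (t ^ k / fact k) *\<^sub>R (T ^^ k) x)" for t x
  proof (rule summable_comparison_test'[OF summable_exp[of t x]])
    fix k
    have "norm ((t ^ k / fact k) *\<^sub>R (T ^^ k) x) \<le> \<bar>t\<bar> ^ k / fact k * (K ^ k * norm x)"
      using mult_left_mono[OF power_bound[of k x], of "\<bar>t\<bar> ^ k / fact k"]
      by (simp add: power_abs)
    then show "norm ((t ^ k / fact k) *\<^sub>R (T ^^ k) x) \<le> (\<bar>t\<bar> * K) ^ k / fact k * norm x"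
      by (simp add: power_mult_distrib)
  qed
  have T_E: "T (E t x) = E t (T x)" for t x
    unfolding E_def bounded_linear.suminf[OF T sm]
    by (simp add: linear_cmul[OF bounded_linear.linear[OF T]] funpow_swap1[of T])
  have "((\<lambda>t. E t x \<bullet> i) has_real_derivative E t (T x) \<bullet> i) (at t)" for i
  proof -
    define c where "c = (\<lambda>k. ((T ^^ k) x \<bullet> i) / fact k)"
    have E_inner: "E t x \<bullet> i = (\<Sum>k. c k * t ^ k)" for t
      unfolding E_def bounded_linear.suminf[OF bounded_linear_inner_left sm] c_def
      by (simp add: mult_ac)
    have "summable (\<lambda>k. c k * t ^ k)" for t
      using bounded_linear.summable[OF bounded_linear_inner_left sm, of t x i]
      by (simp add: c_def mult_ac)
    then have "((\<lambda>t. \<Sum>k. c k * t ^ k) has_field_derivative (\<Sum>k. diffs c k * t ^ k)) (at t)"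
      by (rule termdiffs_strong_converges_everywhere)
    moreover have "(\<Sum>k. diffs c k * t ^ k) = E t (T x) \<bullet> i"
      unfolding E_def bounded_linear.suminf[OF bounded_linear_inner_left sm] c_def diffs_def
      by (simp add: mult_ac funpow_swap1[of T] del: of_nat_Suc)
    ultimately show ?thesis by (simp add: E_inner)
  qed
  then have "((\<lambda>t. E t x) has_vector_derivative E t (T x)) (at t)"
    unfolding has_vector_derivative_def
    by (subst has_derivative_componentwise_within)
      (simp add: has_field_derivative_def inner_scaleR_left mult_commute_abs)
  then show ?thesis by (simp add: T_E)
qed

lemma bounded_linear_matrix_mul_right: "bounded_linear (\<lambda>X. M ** X)" for M :: "real^'n^'n"
  by (auto intro!: linear_conv_bounded_linear[THEN iffD1] linearI
      simp: matrix_add_ldistrib matrix_scalar_ac scalar_matrix_assoc)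

lemma bounded_bilinear_matrix_vector_mult:
  "bounded_bilinear (\<lambda>(M :: real^'n^'n) x. M *v x)"
  by (rule bilinear_conv_bounded_bilinear[THEN iffD1])
    (auto simp: bilinear_def intro!: linearI simp: matrix_vector_mult_add_rdistrib
      scaleR_matrix_vector_assoc matrix_vector_right_distrib matrix_vector_mult_scaleR)

lemma mexp_scaleR:
  "mexp (t *\<^sub>R M) = (\<Sum>k. (t ^ k / fact k) *\<^sub>R ((\<lambda>X. M ** X) ^^ k) (mat 1))"
proof -
  have "((\<lambda>X. (t *\<^sub>R M) ** X) ^^ k) (mat 1) = t ^ k *\<^sub>R ((\<lambda>X. M ** X) ^^ k) (mat 1)" for k
    by (induction k) (simp_all add: matrix_scalar_ac scalar_matrix_assoc[symmetric] mult.commute)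
  then show ?thesis by (simp add: mexp_def)
qed

lemma has_vector_derivative_mexp:
  "((\<lambda>t. mexp (t *\<^sub>R M)) has_vector_derivative M ** mexp (t *\<^sub>R M)) (at t)"
  unfolding mexp_scaleR by (rule has_vector_derivative_exp_series[OF bounded_linear_matrix_mul_right])

lemma mexp_0: "mexp (0 :: real^'n^'n) = mat 1"
proof -
  have "mexp (0 *\<^sub>R (0 :: real^'n^'n)) = mat 1"
    unfolding mexp_scaleR by (subst suminf_finite[of "{0}"]) (auto simp: power_0_left)
  then show ?thesis by simp
qed

lemma has_vector_derivative_mexp_vec:
  "((\<lambda>t. mexp (t *\<^sub>R M) *v x) has_vector_derivative M *v (mexp (t *\<^sub>R M) *v x)) (at t)"
  using bounded_linear.has_vector_derivative[OF
      bounded_bilinear.bounded_linear_left[OF bounded_bilinear_matrix_vector_mult]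
      has_vector_derivative_mexp]
  by (simp add: matrix_vector_mul_assoc)

lemma continuous_mexp: "continuous_on S (\<lambda>t. mexp (t *\<^sub>R A))"
  by (rule continuous_on_vector_derivative)
    (rule has_vector_derivative_at_within[OF has_vector_derivative_mexp])

section \<open>Right-continuous integrands\<close>

text \<open>
  A right-continuous function is the pointwise limit of its values at the next grid point to the
  right, as the mesh tends to zero.
\<close>

lemma borel_measurable_right_continuous:
  fixes g :: "real \<Rightarrow> 'a::metric_space"
  assumes "\<And>t. continuous (at_right t) g"
  shows "g \<in> borel_measurable borel"
proof (rule borel_measurable_LIMSEQ_metric)
  define q where "q = (\<lambda>i (x::real). (of_int \<lfloor>real (Suc i) * x\<rfloor> + 1) / real (Suc i))"
  fix i :: nat
  have "(\<lambda>n::int. g ((of_int n + 1) / real (Suc i))) \<circ> (\<lambda>x. \<lfloor>real (Suc i) * x\<rfloor>)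
      \<in> borel_measurable borel"
    by (rule measurable_comp[where N = "count_space UNIV"]) measurable
  then show "(\<lambda>x. g (q i x)) \<in> borel_measurable borel"
    by (simp add: q_def o_def)
next
  define q where "q = (\<lambda>i (x::real). (of_int \<lfloor>real (Suc i) * x\<rfloor> + 1) / real (Suc i))"
  fix x :: real
  have lower: "x < q i x" for i
  proof -
    have "x * real (Suc i) < of_int \<lfloor>real (Suc i) * x\<rfloor> + 1"
      by (subst mult.commute) linarith
    then show ?thesis unfolding q_def by (subst pos_less_divide_eq) auto
  qed
  have upper: "q i x \<le> x + 1 / real (Suc i)" for i
  proof -
    have "of_int \<lfloor>real (Suc i) * x\<rfloor> \<le> x * real (Suc i)"
      by (subst mult.commute) (rule of_int_floor_le)
    then have "of_int \<lfloor>real (Suc i) * x\<rfloor> / real (Suc i) \<le> x"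
      by (subst pos_divide_le_eq) auto
    then show ?thesis unfolding q_def add_divide_distrib by linarith
  qed
  have "(\<lambda>i. x + 1 / real (Suc i)) \<longlonglongrightarrow> x + 0"
    by (intro tendsto_add tendsto_const LIMSEQ_inverse_real_of_nat[unfolded inverse_eq_divide])
  then have lim: "(\<lambda>i. x + 1 / real (Suc i)) \<longlonglongrightarrow> x" by simp
  have "(\<lambda>i. q i x) \<longlonglongrightarrow> x"
    by (rule real_tendsto_sandwich[OF _ _ tendsto_const lim])
      (intro always_eventually allI less_imp_le lower upper)+
  then have "filterlim (\<lambda>i. q i x) (at_right x) sequentially"
    using lower less_imp_neq[OF lower, symmetric] by (simp add: filterlim_at)
  then show "(\<lambda>i. g (q i x)) \<longlonglongrightarrow> g x"
    using assms[of x] unfolding continuous_within by (rule filterlim_compose[rotated])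
qed

lemma has_integral_exp_fading:
  fixes \<gamma> t :: real
  assumes "\<gamma> > 0"
  shows "((\<lambda>r. exp (- \<gamma> * (t - r))) has_integral 1 / \<gamma>) {..t}"
proof -
  let ?f = "\<lambda>x. indicator {0..} x *\<^sub>R exp (- \<gamma> * x)"
  have "((\<lambda>x. exp (- \<gamma> * x)) has_integral 1 / \<gamma>) {0..}"
    using has_integral_exp_minus_to_infinity[OF assms, of 0] by simp
  then have "has_bochner_integral lebesgue ?f (1 / \<gamma>)"
    using nonnegative_absolutely_integrable_1[of "\<lambda>x. exp (- \<gamma> * x)" "{0..}"]
      set_lebesgue_integral_eq_integral[of "{0..}" "\<lambda>x. exp (- \<gamma> * x)"]
    by (auto simp: has_bochner_integral_iff set_integrable_def set_lebesgue_integral_def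
        has_integral_iff)
  then have "has_bochner_integral lebesgue (\<lambda>r. ?f (t + (- 1) * r)) (1 / \<gamma>)"
    by (subst (asm) has_bochner_integral_lebesgue_real_affine_iff[where t = t and c = "- 1"]) auto
  also have "(\<lambda>r. ?f (t + (- 1) * r)) = (\<lambda>r. indicator {..t} r *\<^sub>R exp (- \<gamma> * (t - r)))"
    by (auto simp: fun_eq_iff indicator_def)
  finally show ?thesis
    using set_lebesgue_integral_eq_integral[of "{..t}" "\<lambda>r. exp (- \<gamma> * (t - r))"]
    by (auto simp: has_bochner_integral_iff set_integrable_def set_lebesgue_integral_def
        has_integral_iff)
qed

lemma has_vector_derivative_0_if_quadratic:
  fixes e :: "real \<Rightarrow> 'a::real_normed_vector"
  assumes "\<And>u. t \<le> u \<Longrightarrow> norm (e u) \<le> c * (u - t)\<^sup>2"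
  shows "(e has_vector_derivative 0) (at_right t)"
  unfolding has_vector_derivative_def
proof (rule has_derivativeI_sandwich[of 1])
  have e0: "e t = 0" using assms[of t] by simp
  fix u :: real assume "u \<in> {t<..}"
  then show "norm (e u - e t - (u - t) *\<^sub>R 0) / norm (u - t) \<le> c * (u - t)"
    using assms[of u] e0 by (simp add: divide_simps power2_eq_square mult_ac)
next
  have "((\<lambda>u. c * (u - t)) \<longlongrightarrow> c * (t - t)) (at_right t)" by (intro tendsto_intros)
  then show "((\<lambda>u. c * (u - t)) \<longlongrightarrow> 0) (at_right t)" by simp
qed (auto simp: bounded_linear_zero)

lemma has_vector_derivative_integral_right:
  fixes g :: "real \<Rightarrow> 'a::banach"
  assumes "t < b" "g integrable_on {t..b}" "continuous (at_right t) g"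
  shows "((\<lambda>u. integral {t..u} g) has_vector_derivative g t) (at_right t)"
  using integral_has_vector_derivative_continuous_at[OF assms(2), of t "{}"] assms
  by (simp add: at_within_Icc_at_right)

section \<open>The bounded solution of a dissipative linear equation\<close>

text \<open>
  For dissipative \<open>A\<close> and bounded right-continuous \<open>g\<close>, the bounded solution on the whole line of
  \<open>w' = A w + g\<close>, read with right derivatives. When the integrand is not integrable the value is the
  default \<open>0\<close> of the integral.
\<close>

definition fading_integral ::
  "real^'n^'n \<Rightarrow> (real \<Rightarrow> real^'n) \<Rightarrow> real \<Rightarrow> real^'n" where
  "fading_integral A g t = integral {..t} (\<lambda>r. mexp ((t - r) *\<^sub>R A) *v g r)"

context dissipative
begin

lemma norm_mexp_le:
  assumes "0 \<le> t"
  shows "norm (mexp (t *\<^sub>R A) *v x) \<le> exp (- \<gamma> * t) * norm x"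
proof -
  have "norm (mexp (t *\<^sub>R A) *v x) \<le> exp (- (\<gamma> - 0) * t) * norm (mexp (0 *\<^sub>R A) *v x)
    + 0 / (\<gamma> - 0) * (1 - exp (- (\<gamma> - 0) * t))"
  proof (rule norm_le_comparison[OF assms, where h = "\<lambda>_. 0"])
    show "continuous_on {0..t} (\<lambda>s. mexp (s *\<^sub>R A) *v x)"
      by (rule continuous_on_vector_derivative)
        (rule has_vector_derivative_at_within[OF has_vector_derivative_mexp_vec])
  qed (use rate_pos in \<open>auto intro!: has_vector_derivative_at_within[OF has_vector_derivative_mexp_vec]\<close>)
  then show ?thesis by (simp add: mexp_0)
qed

text \<open>
  The semigroup law, for a forward second step: both sides solve \<open>y' = A y\<close> with the same initial
  value, so their difference vanishes by dissipativity.
\<close>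

lemma mexp_add:
  assumes "0 \<le> t"
  shows "mexp ((s + t) *\<^sub>R A) *v x = mexp (t *\<^sub>R A) *v (mexp (s *\<^sub>R A) *v x)"
proof -
  define d where "d = (\<lambda>r. mexp ((s + r) *\<^sub>R A) *v x - mexp (r *\<^sub>R A) *v (mexp (s *\<^sub>R A) *v x))"
  have deriv: "(d has_vector_derivative A *v d r) (at r within S)" for r S
  proof -
    have "((\<lambda>r. s + r) has_real_derivative 1) (at r)"
      by (auto intro!: derivative_eq_intros)
    from vector_diff_chain_at[OF this[unfolded has_real_derivative_iff_has_vector_derivative]
        has_vector_derivative_mexp_vec[of A x]]
    have "((\<lambda>r. mexp ((s + r) *\<^sub>R A) *v x) has_vector_derivative A *v (mexp ((s + r) *\<^sub>R A) *v x)) (at r)"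
      by (simp add: o_def)
    from has_vector_derivative_diff[OF this has_vector_derivative_mexp_vec[of A "mexp (s *\<^sub>R A) *v x" r]]
    show ?thesis
      by (simp add: d_def matrix_vector_mult_diff_distrib has_vector_derivative_at_within)
  qed
  have "norm (d t) \<le> exp (- (\<gamma> - 0) * t) * norm (d 0) + 0 / (\<gamma> - 0) * (1 - exp (- (\<gamma> - 0) * t))"
    using deriv rate_pos
    by (intro norm_le_comparison[OF assms, where h = "\<lambda>_. 0"] continuous_on_vector_derivative) auto
  also have "d 0 = 0" by (simp add: d_def mexp_0)
  finally show ?thesis by (simp add: d_def)
qed

lemma norm_mexp_diff_le:
  assumes "0 \<le> t"
  shows "norm (mexp (t *\<^sub>R A) *v x - x) \<le> opnorm A * norm x * t"
proof -
  have "((\<lambda>s. A *v (mexp (s *\<^sub>R A) *v x)) has_integral mexp (t *\<^sub>R A) *v x - mexp (0 *\<^sub>R A) *v x) (cbox 0 t)"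
    using assms
    by (simp only: cbox_interval, intro fundamental_theorem_of_calculus
        has_vector_derivative_at_within[OF has_vector_derivative_mexp_vec])
  then have "norm (mexp (t *\<^sub>R A) *v x - mexp (0 *\<^sub>R A) *v x) \<le> opnorm A * norm x * measure lborel (cbox 0 t)"
  proof (rule has_integral_bound[rotated])
    fix s assume "s \<in> cbox 0 t"
    then have "0 \<le> s" by simp
    then have "exp (- \<gamma> * s) * norm x \<le> 1 * norm x"
      using rate_pos by (intro mult_right_mono) auto
    then have le: "norm (mexp (s *\<^sub>R A) *v x) \<le> norm x"
      using norm_mexp_le[OF \<open>0 \<le> s\<close>, of x] by simp
    have "norm (A *v (mexp (s *\<^sub>R A) *v x)) \<le> opnorm A * norm (mexp (s *\<^sub>R A) *v x)"
      unfolding opnorm_def by (intro onorm matrix_vector_mul_bounded_linear)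
    also have "\<dots> \<le> opnorm A * norm x"
      unfolding opnorm_def by (intro mult_left_mono le onorm_pos_le matrix_vector_mul_bounded_linear)
    finally show "norm (A *v (mexp (s *\<^sub>R A) *v x)) \<le> opnorm A * norm x" .
  qed (auto simp: opnorm_def onorm_pos_le)
  then show ?thesis using assms by (simp add: mexp_0)
qed

context
  fixes g :: "real \<Rightarrow> real^'n" and M :: real
  assumes right_cont: "\<And>t. continuous (at_right t) g"
    and bounded: "\<And>t. norm (g t) \<le> M"
begin

lemma bound_nonneg: "0 \<le> M"
  using order_trans[OF norm_ge_zero bounded] .

lemma continuous_right_fading_integrand: "continuous (at_right r) (\<lambda>r. mexp ((t - r) *\<^sub>R A) *v g r)"
proof -
  have "continuous_on UNIV (\<lambda>r. mexp ((t - r) *\<^sub>R A))"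
    by (rule continuous_on_compose2[OF continuous_mexp]) (auto intro!: continuous_intros)
  then have "continuous (at r) (\<lambda>r. mexp ((t - r) *\<^sub>R A))"
    by (simp add: continuous_on_eq_continuous_within)
  then have "continuous (at_right r) (\<lambda>r. mexp ((t - r) *\<^sub>R A))"
    by (rule continuous_at_imp_continuous_at_within)
  from bounded_bilinear.continuous[OF bounded_bilinear_matrix_vector_mult this right_cont]
  show ?thesis .
qed

lemma norm_fading_integrand_le:
  assumes "r \<le> t"
  shows "norm (mexp ((t - r) *\<^sub>R A) *v g r) \<le> M * exp (- \<gamma> * (t - r))"
proof -
  have "norm (mexp ((t - r) *\<^sub>R A) *v g r) \<le> exp (- \<gamma> * (t - r)) * norm (g r)"
    using assms by (intro norm_mexp_le) simp
  also have "\<dots> \<le> exp (- \<gamma> * (t - r)) * M" by (intro mult_left_mono bounded) simp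
  finally show ?thesis by (simp add: mult.commute)
qed

lemma has_integral_dominating: "((\<lambda>r. M * exp (- \<gamma> * (t - r))) has_integral M * (1 / \<gamma>)) {..t}"
  by (intro has_integral_mult_right has_integral_exp_fading rate_pos)

lemma integrable_fading: "(\<lambda>r. mexp ((t - r) *\<^sub>R A) *v g r) integrable_on {..t}"
proof (rule measurable_bounded_by_integrable_imp_integrable)
  have "(\<lambda>r. mexp ((t - r) *\<^sub>R A) *v g r) \<in> borel_measurable borel"
    by (intro borel_measurable_right_continuous continuous_right_fading_integrand)
  then show "(\<lambda>r. mexp ((t - r) *\<^sub>R A) *v g r) \<in> borel_measurable (lebesgue_on {..t})"
    by (intro measurable_restrict_space1 measurable_completion) simp
  show "(\<lambda>r. M * exp (- \<gamma> * (t - r))) integrable_on {..t}"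
    using has_integral_dominating by blast
qed (use norm_fading_integrand_le in auto)

lemma norm_fading_integral_le: "norm (fading_integral A g t) \<le> M / \<gamma>"
proof -
  have "norm (fading_integral A g t) \<le> integral {..t} (\<lambda>r. M * exp (- \<gamma> * (t - r)))"
    unfolding fading_integral_def
  proof (rule Henstock_Kurzweil_Integration.integral_norm_bound_integral[OF integrable_fading])
    show "(\<lambda>r. M * exp (- \<gamma> * (t - r))) integrable_on {..t}"
      using has_integral_dominating by blast
  qed (use norm_fading_integrand_le in auto)
  then show ?thesis unfolding integral_unique[OF has_integral_dominating] by simp
qed

lemma integrable_on_Icc: "g integrable_on {a..b}"
proof (rule measurable_bounded_by_integrable_imp_integrable)
  show "g \<in> borel_measurable (lebesgue_on {a..b})"
    by (intro measurable_restrict_space1 measurable_completion)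
      (simp add: borel_measurable_right_continuous[OF right_cont])
qed (auto intro!: bounded)

text \<open>Variation of constants from time \<open>s\<close> to time \<open>t\<close>.\<close>

lemma fading_integral_step:
  assumes "s \<le> t"
  shows "fading_integral A g t = mexp ((t - s) *\<^sub>R A) *v fading_integral A g s
    + integral {s..t} (\<lambda>r. mexp ((t - r) *\<^sub>R A) *v g r)"
proof -
  let ?f = "\<lambda>r. mexp ((t - r) *\<^sub>R A) *v g r"
  have "((\<lambda>x. mexp ((t - s) *\<^sub>R A) *v x) \<circ> (\<lambda>r. mexp ((s - r) *\<^sub>R A) *v g r) has_integral
      mexp ((t - s) *\<^sub>R A) *v fading_integral A g s) {..s}"
    unfolding fading_integral_def
    by (intro has_integral_linear integrable_integral integrable_fading matrix_vector_mul_bounded_linear)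
  moreover have "mexp ((t - s) *\<^sub>R A) *v (mexp ((s - r) *\<^sub>R A) *v g r) = ?f r" for r
    using mexp_add[of "t - s" "s - r" "g r"] assms by simp
  ultimately have 1: "(?f has_integral mexp ((t - s) *\<^sub>R A) *v fading_integral A g s) {..s}"
    by (simp add: o_def)
  have 2: "(?f has_integral integral {s..t} ?f) {s..t}"
    by (intro integrable_integral integrable_on_subinterval[OF integrable_fading]) auto
  have "{..s} \<inter> {s..t} = {s}" "{..s} \<union> {s..t} = {..t}" using assms by auto
  with has_integral_Un[OF 1 2] have
    "(?f has_integral mexp ((t - s) *\<^sub>R A) *v fading_integral A g s + integral {s..t} ?f) {..t}"
    by simp
  then show ?thesis by (simp add: fading_integral_def integral_unique)
qed

lemma norm_fading_integral_diff_le: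
  assumes "s \<le> t"
  shows "norm (fading_integral A g t - fading_integral A g s) \<le> (opnorm A * (M / \<gamma>) + M) * (t - s)"
proof -
  let ?f = "\<lambda>r. mexp ((t - r) *\<^sub>R A) *v g r" and ?y = "fading_integral A g s"
  have nonneg: "0 \<le> opnorm A" by (simp add: opnorm_def onorm_pos_le)
  have "norm (integral {s..t} ?f) \<le> M * measure lborel (cbox s t)"
  proof (rule has_integral_bound)
    show "(?f has_integral integral {s..t} ?f) (cbox s t)"
      unfolding cbox_interval
      by (intro integrable_integral integrable_on_subinterval[OF integrable_fading]) auto
    fix r assume "r \<in> cbox s t"
    then have "norm (?f r) \<le> M * exp (- \<gamma> * (t - r))" "exp (- \<gamma> * (t - r)) \<le> 1"
      using norm_fading_integrand_le[of r t] rate_pos by auto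
    then show "norm (?f r) \<le> M"
      using mult_left_mono[OF _ bound_nonneg, of "exp (- \<gamma> * (t - r))" 1] by simp
  qed (rule bound_nonneg)
  moreover have "norm (mexp ((t - s) *\<^sub>R A) *v ?y - ?y) \<le> opnorm A * (M / \<gamma>) * (t - s)"
  proof -
    have "norm (mexp ((t - s) *\<^sub>R A) *v ?y - ?y) \<le> opnorm A * norm ?y * (t - s)"
      using assms by (intro norm_mexp_diff_le) simp
    also have "\<dots> \<le> opnorm A * (M / \<gamma>) * (t - s)"
      using assms nonneg by (intro mult_right_mono mult_left_mono norm_fading_integral_le) auto
    finally show ?thesis .
  qed
  ultimately show ?thesis
    using norm_triangle_ineq[of "mexp ((t - s) *\<^sub>R A) *v ?y - ?y" "integral {s..t} ?f"] assms
    by (simp add: fading_integral_step[OF assms] algebra_simps)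
qed

lemma continuous_on_fading_integral: "continuous_on S (fading_integral A g)"
proof -
  have "opnorm A * (M / \<gamma>) + M \<ge> 0"
    using bound_nonneg rate_pos by (simp add: opnorm_def onorm_pos_le)
  moreover have "dist (fading_integral A g s) (fading_integral A g t)
    \<le> (opnorm A * (M / \<gamma>) + M) * dist s t" for s t
    using norm_fading_integral_diff_le[of s t] norm_fading_integral_diff_le[of t s]
    by (cases "s \<le> t") (auto simp: dist_norm norm_minus_commute)
  ultimately have "(opnorm A * (M / \<gamma>) + M)-lipschitz_on S (fading_integral A g)"
    by (intro lipschitz_onI) auto
  then show ?thesis by (rule lipschitz_on_continuous_on)
qed

lemma has_vector_derivative_fading_integral:
  "(fading_integral A g has_vector_derivative A *v fading_integral A g t + g t) (at_right t)"
proof -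
  let ?y = "fading_integral A g t"
  \<comment> \<open>Replacing the exponential by the identity on \<open>{t..u}\<close> costs an error of order \<open>(u - t)\<^sup>2\<close>.\<close>
  define e where "e = (\<lambda>u. integral {t..u} (\<lambda>r. mexp ((u - r) *\<^sub>R A) *v g r - g r))"
  have int: "(\<lambda>r. mexp ((u - r) *\<^sub>R A) *v g r) integrable_on {t..u}" for u
    by (intro integrable_on_subinterval[OF integrable_fading]) auto
  have nonneg: "0 \<le> opnorm A" by (simp add: opnorm_def onorm_pos_le)
  have "norm (e u) \<le> opnorm A * M * (u - t)\<^sup>2" if "t \<le> u" for u
  proof -
    have "norm (e u) \<le> opnorm A * M * (u - t) * measure lborel (cbox t u)"
    proof (rule has_integral_bound)
      show "((\<lambda>r. mexp ((u - r) *\<^sub>R A) *v g r - g r) has_integral e u) (cbox t u)"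
        unfolding e_def cbox_interval
        by (intro integrable_integral integrable_diff int integrable_on_Icc)
      fix r assume "r \<in> cbox t u"
      then have r: "t \<le> r" "r \<le> u" by auto
      then have "norm (mexp ((u - r) *\<^sub>R A) *v g r - g r) \<le> opnorm A * norm (g r) * (u - r)"
        by (intro norm_mexp_diff_le) simp
      also have "\<dots> \<le> opnorm A * M * (u - t)"
        using r nonneg bound_nonneg by (intro mult_mono bounded mult_nonneg_nonneg) auto
      finally show "norm (mexp ((u - r) *\<^sub>R A) *v g r - g r) \<le> opnorm A * M * (u - t)" .
    qed (use nonneg bound_nonneg that in auto)
    then show ?thesis using that by (simp add: power2_eq_square mult_ac)
  qed
  then have e: "(e has_vector_derivative 0) (at_right t)"
    by (rule has_vector_derivative_0_if_quadratic)
  have g: "((\<lambda>u. integral {t..u} g) has_vector_derivative g t) (at_right t)"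
    by (rule has_vector_derivative_integral_right[of t "t + 1"]) (auto intro: integrable_on_Icc right_cont)
  have "((\<lambda>u. u - t) has_real_derivative 1) (at t)" by (auto intro!: derivative_eq_intros)
  from vector_diff_chain_at[OF this[unfolded has_real_derivative_iff_has_vector_derivative]
      has_vector_derivative_mexp_vec[of A ?y]]
  have "((\<lambda>u. mexp ((u - t) *\<^sub>R A) *v ?y) has_vector_derivative A *v ?y) (at t)"
    by (simp add: o_def mexp_0)
  then have m: "((\<lambda>u. mexp ((u - t) *\<^sub>R A) *v ?y) has_vector_derivative A *v ?y) (at_right t)"
    by (rule has_vector_derivative_at_within)
  have "((\<lambda>u. mexp ((u - t) *\<^sub>R A) *v ?y + integral {t..u} g + e u)
      has_vector_derivative A *v ?y + g t + 0) (at_right t)"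
    by (intro has_vector_derivative_add m g e)
  then have D: "((\<lambda>u. mexp ((u - t) *\<^sub>R A) *v ?y + integral {t..u} g + e u)
      has_vector_derivative A *v ?y + g t) (at t within {t..})"
    by (simp add: at_within_Ici_at_right)
  have "fading_integral A g u = mexp ((u - t) *\<^sub>R A) *v ?y + integral {t..u} g + e u"
    if "u \<in> {t..}" for u
    unfolding e_def integral_diff[OF int integrable_on_Icc]
    using fading_integral_step[of t u] that by simp
  from has_vector_derivative_transform[OF _ this D] show ?thesis
    by (simp add: at_within_Ici_at_right)
qed

end

end

section \<open>The frozen equation and its critical trajectory\<close>

lemma continuous_right_lipschitz_compose:
  fixes f :: "'a::real_normed_vector \<Rightarrow> 'b::real_normed_vector"
  assumes "\<And>x x'. norm (f x - f x') \<le> L * norm (x - x')" and "continuous F g"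
  shows "continuous F (\<lambda>r. f (g r))"
  unfolding continuous_def
proof (rule Lim_null[THEN iffD2], rule Lim_null_comparison)
  show "\<forall>\<^sub>F r in F. norm (f (g r) - f (g (Lim F (\<lambda>x. x)))) \<le> L * norm (g r - g (Lim F (\<lambda>x. x)))"
    by (intro always_eventually allI assms)
  have "((\<lambda>r. L * norm (g r - g (Lim F (\<lambda>x. x)))) \<longlongrightarrow> L * norm (g (Lim F (\<lambda>x. x)) - g (Lim F (\<lambda>x. x)))) F"
    using assms(2) unfolding continuous_def by (intro tendsto_intros)
  then show "((\<lambda>r. L * norm (g r - g (Lim F (\<lambda>x. x)))) \<longlongrightarrow> 0) F" by simp
qed

lemma continuous_right_add:
  fixes w p :: "real \<Rightarrow> 'a::real_normed_vector"
  assumes "continuous_on UNIV w" "continuous (at_right t) p"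
  shows "continuous (at_right t) (\<lambda>r. w r + p r)"
proof (rule continuous_add[OF continuous_at_imp_continuous_at_within assms(2)])
  show "continuous (at t) w" using assms(1) by (simp add: continuous_on_eq_continuous_within)
qed

text \<open>
  The map sending \<open>w\<close> to the bounded solution with forcing \<open>f (w + p)\<close> contracts the bounded
  continuous functions by the factor \<open>L / \<gamma> < 1\<close>.
\<close>

lemma (in dissipative) bounded_trajectory_exists:
  fixes f :: "real^'n \<Rightarrow> real^'n" and p :: "real \<Rightarrow> real^'n"
  assumes L: "0 \<le> L" "L < \<gamma>"
    and lip: "\<And>x x'. norm (f x - f x') \<le> L * norm (x - x')"
    and bdd: "\<And>x. norm (f x) \<le> M"
    and p: "\<And>t. continuous (at_right t) p"
  shows "\<exists>w. continuous_on UNIV w \<and> (\<forall>t. w t = fading_integral A (\<lambda>r. f (w r + p r)) t)"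
proof -
  define G where "G = (\<lambda>(w :: real \<Rightarrow>\<^sub>C (real^'n)) r. f (w r + p r))"
  have Gc: "continuous (at_right t) (G w)" for w t
  proof -
    have "continuous (at_right t) (\<lambda>r. w r + p r)"
      by (rule continuous_right_add[OF continuous_on_apply_bcontfun p])
    then show ?thesis unfolding G_def by (rule continuous_right_lipschitz_compose[OF lip])
  qed
  have Gb: "norm (G w t) \<le> M" for w t by (simp add: G_def bdd)
  define \<Phi> where "\<Phi> = (\<lambda>w. Bcontfun (fading_integral A (G w)))"
  have \<Phi>: "apply_bcontfun (\<Phi> w) t = fading_integral A (G w) t" for w t
  proof -
    have "fading_integral A (G w) \<in> bcontfun"
      using continuous_on_fading_integral[OF Gc Gb] norm_fading_integral_le[OF Gc Gb]
      by (rule bcontfun_normI)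
    then show ?thesis by (simp add: \<Phi>_def Bcontfun_inverse)
  qed
  have "dist (\<Phi> w) (\<Phi> w') \<le> L / \<gamma> * dist w w'" for w w'
  proof (rule dist_bound)
    fix t
    let ?g = "\<lambda>r. G w r - G w' r"
    have "fading_integral A (G w) t - fading_integral A (G w') t = fading_integral A ?g t"
      unfolding fading_integral_def matrix_vector_mult_diff_distrib
      by (rule Henstock_Kurzweil_Integration.integral_diff[symmetric])
        (rule integrable_fading[OF Gc Gb])+
    moreover have "norm (fading_integral A ?g t) \<le> (L * dist w w') / \<gamma>"
    proof (rule norm_fading_integral_le)
      show "continuous (at_right t) ?g" for t by (intro continuous_diff Gc)
      fix r
      have "norm (?g r) \<le> L * norm (w r - w' r)"
        unfolding G_def using lip[of "w r + p r" "w' r + p r"] by simp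
      also have "\<dots> \<le> L * dist w w'"
        using L dist_bounded[of w r w'] by (intro mult_left_mono) (auto simp: dist_norm)
      finally show "norm (?g r) \<le> L * dist w w'" .
    qed
    ultimately show "dist (\<Phi> w t) (\<Phi> w' t) \<le> L / \<gamma> * dist w w'"
      by (simp add: \<Phi> dist_norm)
  qed
  then have "\<forall>w w'. dist (\<Phi> w) (\<Phi> w') \<le> L / \<gamma> * dist w w'" by blast
  then have "\<exists>!w. \<Phi> w = w"
    by (rule banach_fix_type[rotated 2]) (use L rate_pos in auto)
  then obtain w where "\<Phi> w = w" by blast
  then have "apply_bcontfun w t = fading_integral A (\<lambda>r. f (w r + p r)) t" for t
    using \<Phi>[of w t] by (simp add: G_def)
  then show ?thesis
    by (intro exI[of _ "apply_bcontfun w"] conjI allI continuous_on_apply_bcontfun)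
qed

text \<open>
  The value \<open>critical_F A U \<zeta> \<omega> y\<close> is the endpoint at time \<open>0\<close> of a bounded solution of the frozen
  equation on the negative half-line. Existence suffices: every frozen solution obeys the same
  bound, so it does not matter which one the choice operator in \<open>critical_F\<close> selects.
\<close>

lemma (in dissipative) critical_F_trajectory:
  fixes U :: "real^'n \<Rightarrow> real^'m \<Rightarrow> real^'n" and \<zeta> :: "(real \<Rightarrow> real^'n) \<Rightarrow> real^'n"
    and \<omega> :: "real \<Rightarrow> real^'n" and y :: "real^'m"
  defines "p \<equiv> \<lambda>r. \<zeta> (path_shift r \<omega>)"
  assumes L: "0 \<le> L" "L < \<gamma>"
    and lip: "\<And>x x'. norm (U x y - U x' y) \<le> L * norm (x - x')"
    and bdd: "\<And>x. norm (U x y) \<le> M"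
    and p: "\<And>t. continuous (at_right t) p"
  shows "\<exists>w. continuous_on UNIV w \<and> (\<forall>s. norm (w s) \<le> M / \<gamma>) \<and>
    (\<forall>s<0. (w has_vector_derivative A *v w s + U (w s + p s) y) (at_right s)) \<and>
    w 0 = critical_F A U \<zeta> \<omega> y"
proof -
  have ex: "\<exists>W. frozen_solution A U \<zeta> \<omega> y W"
  proof -
    obtain W where W: "continuous_on UNIV W"
      "\<And>t. W t = fading_integral A (\<lambda>r. U (W r + p r) y) t"
      using bounded_trajectory_exists[OF L, of "\<lambda>x. U x y" M p] lip bdd p by blast
    have "continuous (at_right t) (\<lambda>r. W r + p r)" for t
      by (rule continuous_right_add[OF W(1) p])
    then have "continuous (at_right t) (\<lambda>r. U (W r + p r) y)" for t
      by (rule continuous_right_lipschitz_compose[OF lip])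
    from integrable_integral[OF integrable_fading[OF this bdd]]
    have "((\<lambda>r. mexp ((t - r) *\<^sub>R A) *v U (W r + p r) y) has_integral W t) {..t}" for t
      unfolding fading_integral_def[symmetric] W(2)[symmetric] .
    then show ?thesis
      using continuous_on_subset[OF W(1)] by (auto simp: frozen_solution_def p_def)
  qed
  define W where "W = (SOME W. frozen_solution A U \<zeta> \<omega> y W)"
  have "frozen_solution A U \<zeta> \<omega> y W"
    unfolding W_def by (rule someI_ex[OF ex])
  then have W_cont: "continuous_on {..0} W"
    and W: "\<And>t. t \<le> 0 \<Longrightarrow> ((\<lambda>r. mexp ((t - r) *\<^sub>R A) *v U (W r + p r) y) has_integral W t) {..t}"
    by (auto simp: frozen_solution_def p_def)
  have F: "critical_F A U \<zeta> \<omega> y = W 0"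
    using integral_unique[OF W[of 0]] by (simp add: critical_F_def W_def[symmetric] p_def)
  \<comment> \<open>Nothing is known of \<open>W\<close> at positive times, so it is continued by the constant \<open>W 0\<close>.\<close>
  define g where "g = (\<lambda>r. U (W (min r 0) + p r) y)"
  have "continuous_on UNIV (\<lambda>r. W (min r 0))"
    by (rule continuous_on_compose2[OF W_cont]) (auto intro!: continuous_intros)
  then have "continuous (at_right t) (\<lambda>r. W (min r 0) + p r)" for t
    by (rule continuous_right_add[OF _ p])
  then have g_cont: "continuous (at_right t) g" for t
    unfolding g_def by (rule continuous_right_lipschitz_compose[OF lip])
  have g_bdd: "norm (g t) \<le> M" for t by (simp add: g_def bdd)
  have W_eq: "fading_integral A g t = W t" if "t \<le> 0" for t
  proof -
    have "fading_integral A g t = integral {..t} (\<lambda>r. mexp ((t - r) *\<^sub>R A) *v U (W r + p r) y)"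
      unfolding fading_integral_def using that
      by (intro Henstock_Kurzweil_Integration.integral_cong) (simp add: g_def)
    then show ?thesis using integral_unique[OF W[OF that]] by simp
  qed
  show ?thesis
  proof (intro exI[of _ "fading_integral A g"] conjI allI impI)
    show "continuous_on UNIV (fading_integral A g)" by (rule continuous_on_fading_integral[OF g_cont g_bdd])
    show "norm (fading_integral A g s) \<le> M / \<gamma>" for s by (rule norm_fading_integral_le[OF g_cont g_bdd])
    show "fading_integral A g 0 = critical_F A U \<zeta> \<omega> y" by (simp add: W_eq F)
    fix s :: real assume "s < 0"
    then have "g s = U (W s + p s) y" by (simp add: g_def)
    also have "W s = fading_integral A g s" using \<open>s < 0\<close> by (simp add: W_eq)
    finally have "g s = U (fading_integral A g s + p s) y" .
    then show "(fading_integral A g has_vector_derivative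
        A *v fading_integral A g s + U (fading_integral A g s + p s) y) (at_right s)"
      using has_vector_derivative_fading_integral[OF g_cont g_bdd, of s] by simp
  qed
qed

section \<open>Dissipativity from the exponential bound\<close>

text \<open>
  Since the constant in front of the exponential is \<open>1\<close>, the bound is an equality at time \<open>0\<close> and can
  be differentiated there.
\<close>

lemma dissipative_if_exp_bound:
  fixes B :: "real^'m^'m"
  assumes bound: "\<And>t. t > 0 \<Longrightarrow> opnorm (mexp (t *\<^sub>R B)) \<le> exp (- \<gamma> * t)"
  shows "(B *v x) \<bullet> x \<le> - \<gamma> * (norm x)\<^sup>2"
proof (rule ccontr)
  assume neg: "\<not> (B *v x) \<bullet> x \<le> - \<gamma> * (norm x)\<^sup>2"
  let ?E = "\<lambda>t. mexp (t *\<^sub>R B) *v x"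
  define \<phi> where "\<phi> = (\<lambda>t. ?E t \<bullet> ?E t - exp (- 2 * \<gamma> * t) * (x \<bullet> x))"
  have "(?E has_derivative (\<lambda>h. h *\<^sub>R (B *v x))) (at 0)"
    using has_vector_derivative_mexp_vec[of B x 0]
    by (simp add: has_vector_derivative_def mexp_0)
  from has_derivative_inner[OF this this]
  have "((\<lambda>t. ?E t \<bullet> ?E t) has_real_derivative 2 * ((B *v x) \<bullet> x)) (at 0)"
    by (simp add: has_field_derivative_def mexp_0 inner_commute algebra_simps
        mult_commute_abs)
  moreover have "((\<lambda>t. exp (- 2 * \<gamma> * t) * (x \<bullet> x)) has_real_derivative - 2 * \<gamma> * (x \<bullet> x)) (at 0)"
    by (auto intro!: derivative_eq_intros)
  ultimately have "(\<phi> has_real_derivative 2 * ((B *v x) \<bullet> x) - (- 2 * \<gamma> * (x \<bullet> x))) (at 0)"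
    unfolding \<phi>_def by (rule DERIV_diff)
  moreover have "2 * ((B *v x) \<bullet> x) - (- 2 * \<gamma> * (x \<bullet> x)) > 0"
    using neg by (simp add: power2_norm_eq_inner)
  ultimately obtain \<delta> where \<delta>: "\<delta> > 0" "\<And>h. 0 < h \<Longrightarrow> h < \<delta> \<Longrightarrow> \<phi> 0 < \<phi> (0 + h)"
    using DERIV_pos_inc_right by blast
  define h where "h = \<delta> / 2"
  have h: "0 < h" "h < \<delta>" using \<delta>(1) by (auto simp: h_def)
  have "norm (?E h) \<le> opnorm (mexp (h *\<^sub>R B)) * norm x"
    unfolding opnorm_def by (intro onorm matrix_vector_mul_bounded_linear)
  also have "\<dots> \<le> exp (- \<gamma> * h) * norm x" by (intro mult_right_mono bound h) simp
  finally have "(norm (?E h))\<^sup>2 \<le> (exp (- \<gamma> * h) * norm x)\<^sup>2" by (intro power_mono) auto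
  then have "\<phi> h \<le> 0"
    by (simp add: \<phi>_def power_mult_distrib power2_norm_eq_inner exp_double[symmetric] mult.assoc)
  moreover have "\<phi> 0 = 0" by (simp add: \<phi>_def mexp_0)
  ultimately show False using \<delta>(2)[OF h] by simp
qed

section \<open>Integral equations\<close>

lemma integral_equation_initial_value:
  fixes y :: "real \<Rightarrow> 'a::euclidean_space"
  assumes int: "\<And>t. 0 \<le> t \<Longrightarrow> (F has_integral y t - c) {0..t}"
  shows "y 0 = c"
  using integral_unique[OF int[of 0]] by simp

lemma integral_equation_continuous:
  fixes y :: "real \<Rightarrow> 'a::euclidean_space"
  assumes int: "\<And>t. 0 \<le> t \<Longrightarrow> (F has_integral y t - c) {0..t}"
  shows "continuous_on {0..T} y"
proof (cases "0 \<le> T")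
  case True
  have "continuous_on {0..T} (\<lambda>t. c + integral {0..t} F)"
    using int[OF True] by (intro continuous_intros indefinite_integral_continuous_1) auto
  then show ?thesis
    by (rule continuous_on_eq) (use integral_unique[OF int] in auto)
qed simp

lemma integral_equation_continuous_right:
  fixes y :: "real \<Rightarrow> 'a::euclidean_space"
  assumes int: "\<And>t. 0 \<le> t \<Longrightarrow> (F has_integral y t - c) {0..t}" and t: "0 \<le> t"
  shows "continuous (at_right t) y"
proof -
  have "continuous (at t within {0..t + 1}) y"
    using integral_equation_continuous[OF int, of "t + 1"] t
    by (auto simp: continuous_on_eq_continuous_within)
  then have "continuous (at t within {t..t + 1}) y"
    by (rule continuous_within_subset) (use t in auto)
  then show ?thesis by (simp add: continuous_within at_within_Icc_at_right)
qed

lemma integral_equation_has_right_derivative: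
  fixes y :: "real \<Rightarrow> 'a::euclidean_space"
  assumes int: "\<And>t. 0 \<le> t \<Longrightarrow> (F has_integral y t - c) {0..t}" and t: "0 \<le> t"
    and F: "continuous (at_right t) F"
  shows "(y has_vector_derivative F t) (at_right t)"
proof -
  have integrable: "F integrable_on {0..u}" if "0 \<le> u" for u using int[OF that] by blast
  have "F integrable_on {t..t + 1}"
    by (rule integrable_subinterval_real[OF integrable[of "t + 1"]]) (use t in auto)
  then have "((\<lambda>u. integral {t..u} F) has_vector_derivative F t) (at_right t)"
    by (intro has_vector_derivative_integral_right[of t "t + 1"] F) auto
  then have D: "((\<lambda>u. y t + integral {t..u} F) has_vector_derivative F t) (at t within {t..})"
    using has_vector_derivative_add[OF has_vector_derivative_const[of "y t"]]
    by (fastforce simp: at_within_Ici_at_right)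
  have "y u = y t + integral {t..u} F" if "u \<in> {t..}" for u
    using Henstock_Kurzweil_Integration.integral_combine[OF t _ integrable[of u]] that t
      integral_unique[OF int, of u] integral_unique[OF int, of t]
    by (simp add: algebra_simps)
  from has_vector_derivative_transform[OF _ this D] show ?thesis
    by (simp add: at_within_Ici_at_right)
qed

section \<open>The constants of the estimate\<close>

text \<open>
  With \<open>\<delta> = \<epsilon> * \<gamma>2\<close>, the choice of \<open>err_t0\<close> turns the first bracket of \<open>err_beta\<close> into
  \<open>(\<mu> / (\<mu> - \<delta>) - 1) / \<gamma>1\<close>.
\<close>

lemma err_beta_nonneg:
  assumes "0 < \<epsilon> * \<gamma>2" "\<epsilon> * \<gamma>2 < \<mu>" "\<mu> < \<gamma>1"
  shows "0 \<le> err_beta \<gamma>1 \<gamma>2 \<mu> \<epsilon>"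
proof -
  define \<delta> where "\<delta> = \<epsilon> * \<gamma>2"
  have \<delta>: "0 < \<delta>" "\<delta> < \<mu>" "\<mu> < \<gamma>1" using assms by (auto simp: \<delta>_def)
  have pos: "0 < (\<gamma>1 - \<delta>) * \<mu>" "0 < (\<mu> - \<delta>) * \<gamma>1" using \<delta> by auto
  have "exp (- \<delta> * err_t0 \<gamma>1 \<gamma>2 \<mu> \<epsilon>) = exp (- ln ((\<mu> - \<delta>) * \<gamma>1 / ((\<gamma>1 - \<delta>) * \<mu>)))"
    using \<delta>(1) by (simp add: err_t0_def \<delta>_def[symmetric])
  also have "\<dots> = (\<gamma>1 - \<delta>) * \<mu> / ((\<mu> - \<delta>) * \<gamma>1)"
    using pos by (simp add: exp_minus)
  finally have "1 / (\<gamma>1 - \<delta>) * exp (- \<delta> * err_t0 \<gamma>1 \<gamma>2 \<mu> \<epsilon>) = \<mu> / (\<mu> - \<delta>) * (1 / \<gamma>1)"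
    using \<delta> by simp
  also have "\<dots> \<ge> 1 * (1 / \<gamma>1)"
    using \<delta> by (intro mult_right_mono) (auto simp: le_divide_eq_1)
  finally have "0 \<le> 1 / (\<gamma>1 - \<delta>) * exp (- \<delta> * err_t0 \<gamma>1 \<gamma>2 \<mu> \<epsilon>) - 1 / \<gamma>1" by simp
  moreover have "0 \<le> 1 / (\<gamma>1 - \<delta>) - 1 / \<gamma>1" using \<delta> by (simp add: frac_le)
  ultimately show ?thesis by (simp add: err_beta_def \<delta>_def[symmetric])
qed

text \<open>
  The right-hand side is \<open>1 + a / (1 - a - b)\<close> for \<open>a = L / (\<gamma> - \<mu>)\<close>, and the left-hand side is
  \<open>1 + a' / (1 - a')\<close> for the smaller \<open>a' = L / \<gamma>\<close>.
\<close>

lemma slow_coefficient_le: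
  fixes b :: real
  assumes "0 < L" "0 < \<mu>" "L < \<gamma> - \<mu>" "0 \<le> b" "L / (\<gamma> - \<mu>) + b < 1"
  shows "1 + L / (\<gamma> - L) \<le> (1 - b) / (1 - (L / (\<gamma> - \<mu>) + b))"
proof -
  define a where "a = L / (\<gamma> - \<mu>)"
  have le: "L / \<gamma> \<le> a" unfolding a_def using assms by (intro frac_le) auto
  have ab: "a + b < 1" using assms by (simp add: a_def)
  have "L / (\<gamma> - L) = (L / \<gamma>) / (1 - L / \<gamma>)" using assms by (simp add: divide_simps)
  also have "\<dots> \<le> a / (1 - (a + b))"
    using le ab assms order_trans[OF _ le, of 0] by (intro frac_le) auto
  finally have "1 + L / (\<gamma> - L) \<le> 1 + a / (1 - (a + b))" by simp
  also have "\<dots> = (1 - b) / (1 - (a + b))"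
    using ab by (simp add: field_simps)
  finally show ?thesis by (simp add: a_def)
qed

section \<open>The error estimate\<close>

lemma (in dissipative) scaleR_dissipative:
  assumes "\<epsilon> > 0" shows "dissipative (\<epsilon> *\<^sub>R A) (\<epsilon> * \<gamma>)"
proof
  show "0 < \<epsilon> * \<gamma>" using assms rate_pos by simp
  show "((\<epsilon> *\<^sub>R A) *v x) \<bullet> x \<le> - (\<epsilon> * \<gamma>) * (norm x)\<^sup>2" for x
    using mult_left_mono[OF dissipative[of x], of \<epsilon>] assms
    by (simp add: scaleR_matrix_vector_assoc[symmetric] mult_ac)
qed

theorem theorem5p2:
  fixes A :: "real^'n^'n" and B :: "real^'m^'m"
    and U :: "real^'n \<Rightarrow> real^'m \<Rightarrow> real^'n" and V :: "real^'n \<Rightarrow> real^'m \<Rightarrow> real^'m"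
    and \<alpha> \<sigma>1 \<gamma>1 \<gamma>2 \<gamma>3 L MU MV \<mu> \<epsilon>0 :: real
    and Q1 :: "(real \<Rightarrow> real^'n) measure"
    and \<zeta> :: "(real \<Rightarrow> real^'n) \<Rightarrow> real^'n" and \<Omega>' :: "(real \<Rightarrow> real^'n) set"
  assumes alpha: "1 < \<alpha>" "\<alpha> < 2"
    and noise: "stable_levy_law \<alpha> Q1"
    and meas: "case_prod U \<in> borel_measurable borel" "case_prod V \<in> borel_measurable borel"
    and sigma: "\<sigma>1 \<noteq> 0"
    and H1: "\<gamma>1 > 0" "\<And>x. (A *v x) \<bullet> x \<le> - \<gamma>1 * (norm x)\<^sup>2"
    and H2: "\<gamma>2 > 0" "\<gamma>3 > 0"
      "\<And>t. t \<le> 0 \<Longrightarrow> opnorm (mexp (t *\<^sub>R B)) \<le> exp (- \<gamma>2 * t)"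
      "\<And>t. t > 0 \<Longrightarrow> opnorm (mexp (t *\<^sub>R B)) \<le> exp (- \<gamma>3 * t)"
    and H3: "L > 0"
      "\<And>x1 y1 x2 y2. norm (U x1 y1 - U x2 y2) \<le> L * (norm (x1 - x2) + norm (y1 - y2))"
      "\<And>x1 y1 x2 y2. norm (V x1 y1 - V x2 y2) \<le> L * (norm (x1 - x2) + norm (y1 - y2))"
    and H4: "\<gamma>1 > L"
    and H5: "bdd_above (range (\<lambda>(x, y). norm (U x y)))" "MU = (SUP (x, y). norm (U x y))"
      "bdd_above (range (\<lambda>(x, y). norm (V x y)))" "MV = (SUP (x, y). norm (V x y))"
    and mu: "\<mu> > 0" "\<gamma>1 - \<mu> > L"
    and eps0: "\<epsilon>0 > 0"
      "\<And>\<epsilon>. 0 < \<epsilon> \<Longrightarrow> \<epsilon> \<le> \<epsilon>0 \<Longrightarrow> \<mu> - \<epsilon> * \<gamma>2 > 0 \<and> L / (\<gamma>1 - \<mu>) + \<epsilon> * L / (\<mu> - \<epsilon> * \<gamma>2) < 1"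
    and zeta: "stationary_solution A \<sigma>1 Q1 \<zeta> \<Omega>'"
  shows "\<exists>C>0. \<forall>\<epsilon> \<omega> u0 v0 z t.
    0 < \<epsilon> \<and> \<epsilon> \<le> \<epsilon>0 \<and> \<omega> \<in> \<Omega>' \<and> rescaled_solution A B U V \<sigma>1 \<epsilon> \<omega> (u0, v0) z \<and> t \<ge> 0 \<longrightarrow>
    sum_norm (z t - reduced_process A U \<zeta> \<omega> v0 t)
      \<le> exp (- \<mu> * t) / (1 - (L / (\<gamma>1 - \<mu>) + \<epsilon> * L / (\<mu> - \<epsilon> * \<gamma>2)))
           * (2 * norm (u0 - \<zeta> \<omega>) + 2 * (MU / \<gamma>1) + MV / \<gamma>2)
        + (1 - \<epsilon> * L / (\<mu> - \<epsilon> * \<gamma>2)) / (1 - (L / (\<gamma>1 - \<mu>) + \<epsilon> * L / (\<mu> - \<epsilon> * \<gamma>2)))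
           * ((norm (B *v v0) + MV) / \<gamma>3) * (1 - exp (- \<epsilon> * \<gamma>3 * t))
        + C * err_beta \<gamma>1 \<gamma>2 \<mu> \<epsilon>"
proof (intro exI[of _ "1::real"] conjI allI impI)
  \<comment> \<open>Any positive constant works, because the error term is nonnegative.\<close>
  fix \<epsilon> t :: real and \<omega> u0 v0 z
  assume asm: "0 < \<epsilon> \<and> \<epsilon> \<le> \<epsilon>0 \<and> \<omega> \<in> \<Omega>' \<and>
    rescaled_solution A B U V \<sigma>1 \<epsilon> \<omega> (u0, v0) z \<and> t \<ge> 0"
  then have \<epsilon>: "0 < \<epsilon>" "\<epsilon> \<le> \<epsilon>0" and \<omega>: "\<omega> \<in> \<Omega>'" and t: "0 \<le> t" by auto
  define a where "a = L / (\<gamma>1 - \<mu>)"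
  define b where "b = \<epsilon> * L / (\<mu> - \<epsilon> * \<gamma>2)"
  have eps: "\<epsilon> * \<gamma>2 < \<mu>" "a + b < 1" using eps0(2)[OF \<epsilon>] by (auto simp: a_def b_def)
  have a: "0 < a" using mu H3(1) by (simp add: a_def)
  have b: "0 < b" using \<epsilon> eps H3(1) by (simp add: b_def)
  have U_le: "norm (U x y) \<le> MU" for x y
    using cSUP_upper[OF _ H5(1), of "(x, y)"] by (simp add: H5(2))
  have V_le: "norm (V x y) \<le> MV" for x y
    using cSUP_upper[OF _ H5(3), of "(x, y)"] by (simp add: H5(4))
  have MU: "0 \<le> MU" and MV: "0 \<le> MV"
    using U_le V_le norm_ge_zero order_trans by blast+
  interpret A: dissipative A \<gamma>1 using H1 by unfold_locales
  interpret B: dissipative B \<gamma>3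
    using H2(2) dissipative_if_exp_bound[OF H2(4)] by unfold_locales
  interpret \<epsilon>B: dissipative "\<epsilon> *\<^sub>R B" "\<epsilon> * \<gamma>3" by (rule B.scaleR_dissipative[OF \<epsilon>(1)])

  \<comment> \<open>Subtracting the stationary solution \<open>p\<close> removes the noise: \<open>x\<close> solves a random ordinary
    integral equation, although \<open>p\<close> and hence its integrand may jump.\<close>
  define p where "p = (\<lambda>r. \<zeta> (path_shift r \<omega>))"
  define x where "x = (\<lambda>r. fst (z r) - p r)"
  define v where "v = (\<lambda>r. snd (z r))"
  have shift_\<Omega>: "path_shift r ` \<Omega>' = \<Omega>'" for r
    using zeta by (simp add: stationary_solution_def)
  have \<omega>0: "\<omega> 0 = 0"
  proof -
    have "\<omega> \<in> path_shift 0 ` \<Omega>'" using \<omega> shift_\<Omega> by simp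
    then show ?thesis by (auto simp: path_shift_def)
  qed
  then have p0: "p 0 = \<zeta> \<omega>" by (simp add: p_def path_shift_def)
  have "cadlag p" and p_int: "\<And>s t. s \<le> t \<Longrightarrow>
      ((\<lambda>r. A *v p r) has_integral p t - p s - \<sigma>1 *\<^sub>R (\<omega> t - \<omega> s)) {s..t}"
    using zeta \<omega> by (auto simp: stationary_solution_def p_def)
  then have p_cont: "continuous (at_right r) p" for r
    by (simp add: cadlag_def continuous_within)
  have u_int: "((\<lambda>s. A *v fst (z s) + U (fst (z s)) (v s)) has_integral
      fst (z r) - u0 - \<sigma>1 *\<^sub>R \<omega> r) {0..r}" if "0 \<le> r" for r
    using asm that by (simp add: rescaled_solution_def v_def)
  have v_int: "((\<lambda>s. \<epsilon> *\<^sub>R (B *v v s) + \<epsilon> *\<^sub>R V (fst (z s)) (v s)) has_integral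
      v r - v0) {0..r}" if "0 \<le> r" for r
    using asm that by (simp add: rescaled_solution_def v_def)
  have x_int: "((\<lambda>s. A *v x s + U (x s + p s) (v s)) has_integral x r - (u0 - \<zeta> \<omega>)) {0..r}"
    if "0 \<le> r" for r
  proof -
    have "((\<lambda>s. (A *v fst (z s) + U (fst (z s)) (v s)) - A *v p s) has_integral
        (fst (z r) - u0 - \<sigma>1 *\<^sub>R \<omega> r) - (p r - p 0 - \<sigma>1 *\<^sub>R (\<omega> r - \<omega> 0))) {0..r}"
      by (intro has_integral_diff u_int p_int that)
    then show ?thesis
      by (simp add: x_def \<omega>0 p0 matrix_vector_mult_diff_distrib algebra_simps)
  qed
  have x0: "x 0 = u0 - \<zeta> \<omega>" by (rule integral_equation_initial_value[OF x_int])
  have v_0: "v 0 = v0" by (rule integral_equation_initial_value[OF v_int])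
  have x_cont: "continuous (at_right r) x" and v_cont: "continuous (at_right r) v" if "0 \<le> r" for r
    using integral_equation_continuous_right[OF x_int that]
      integral_equation_continuous_right[OF v_int that] by auto
  have lip_pair: "continuous (at_right r) (\<lambda>s. f (x s + p s) (v s))"
    if f: "\<And>x1 y1 x2 y2. norm (f x1 y1 - f x2 y2) \<le> L * (norm (x1 - x2) + norm (y1 - y2))"
      and r: "0 \<le> r" for f :: "real^'n \<Rightarrow> real^'m \<Rightarrow> 'c::real_normed_vector" and r
  proof -
    have "((\<lambda>s. L * (norm ((x s + p s) - (x r + p r)) + norm (v s - v r))) \<longlongrightarrow>
        L * (norm ((x r + p r) - (x r + p r)) + norm (v r - v r))) (at_right r)"
      using x_cont[OF r] p_cont[of r] v_cont[OF r] unfolding continuous_within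
      by (intro tendsto_intros)
    then have "((\<lambda>s. f (x s + p s) (v s) - f (x r + p r) (v r)) \<longlongrightarrow> 0) (at_right r)"
      by (intro Lim_null_comparison[OF always_eventually[OF allI[OF f]]]) simp
    then show ?thesis unfolding continuous_within by (rule Lim_null[THEN iffD2])
  qed
  have x_deriv: "(x has_vector_derivative A *v x r + U (x r + p r) (v r)) (at_right r)"
    if "0 \<le> r" for r
  proof (rule integral_equation_has_right_derivative[OF x_int])
    show "continuous (at_right r) (\<lambda>s. A *v x s + U (x s + p s) (v s))"
      by (intro continuous_add bounded_linear.continuous[OF matrix_vector_mul_bounded_linear]
          x_cont lip_pair H3 that)
  qed (use that in auto)
  have v_int': "((\<lambda>s. \<epsilon> *\<^sub>R (B *v v s) + \<epsilon> *\<^sub>R V (x s + p s) (v s)) has_integral v r - v0) {0..r}"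
    if "0 \<le> r" for r using v_int[OF that] by (simp add: x_def)
  have v_deriv: "(v has_vector_derivative \<epsilon> *\<^sub>R (B *v v r) + \<epsilon> *\<^sub>R V (x r + p r) (v r)) (at_right r)"
    if "0 \<le> r" for r
  proof (rule integral_equation_has_right_derivative[OF v_int'])
    show "continuous (at_right r) (\<lambda>s. \<epsilon> *\<^sub>R (B *v v s) + \<epsilon> *\<^sub>R V (x s + p s) (v s))"
      by (intro continuous_add continuous_scaleR continuous_const
          bounded_linear.continuous[OF matrix_vector_mul_bounded_linear] v_cont lip_pair H3 that)
  qed (use that in auto)

  define K where "K = norm (B *v v0) + MV"
  have K: "0 \<le> K" using MV by (simp add: K_def)
  define D where "D = (\<lambda>s. K / \<gamma>3 * (1 - exp (- \<epsilon> * \<gamma>3 * s)))"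
  have D_mono: "D s \<le> D t" if "s \<le> t" for s t
    unfolding D_def using that K \<epsilon> H2 by (intro mult_left_mono) auto
  have D0: "D 0 = 0" by (simp add: D_def)
  have slow: "norm (v s - v0) \<le> D s" if s: "0 \<le> s" for s
  proof -
    have "norm (v s - v0) \<le> exp (- (\<epsilon> * \<gamma>3 - 0) * s) * norm (v 0 - v0)
      + (\<epsilon> * K) / (\<epsilon> * \<gamma>3 - 0) * (1 - exp (- (\<epsilon> * \<gamma>3 - 0) * s))"
    proof (rule \<epsilon>B.norm_le_comparison[OF s,
          where h = "\<lambda>r. \<epsilon> *\<^sub>R (B *v v0 + V (x r + p r) (v r))"])
      show "continuous_on {0..s} (\<lambda>r. v r - v0)"
        by (intro continuous_intros integral_equation_continuous[OF v_int])
    next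
      fix r assume r: "0 \<le> r" "r < s"
      have "((\<lambda>r. v r - v0) has_vector_derivative
          \<epsilon> *\<^sub>R (B *v v r) + \<epsilon> *\<^sub>R V (x r + p r) (v r) - 0) (at_right r)"
        by (intro has_vector_derivative_diff v_deriv r has_vector_derivative_const)
      then show "((\<lambda>r. v r - v0) has_vector_derivative
          (\<epsilon> *\<^sub>R B) *v (v r - v0) + \<epsilon> *\<^sub>R (B *v v0 + V (x r + p r) (v r))) (at_right r)"
        by (simp add: scaleR_matrix_vector_assoc[symmetric] matrix_vector_mult_diff_distrib
            algebra_simps)
      have "norm (B *v v0 + V (x r + p r) (v r)) \<le> K"
        unfolding K_def by (intro order_trans[OF norm_triangle_ineq] add_left_mono V_le)
      then show "norm (\<epsilon> *\<^sub>R (B *v v0 + V (x r + p r) (v r))) \<le> 0 * norm (v r - v0) + \<epsilon> * K"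
        using \<epsilon> by simp
    qed (use \<epsilon> K H2 in auto)
    then show ?thesis using \<epsilon> by (simp add: D_def v_0)
  qed

  \<comment> \<open>The frozen trajectory of the path shifted to time \<open>t\<close>; its time \<open>s\<close> is the time \<open>s + t\<close> of the
    original path.\<close>
  obtain w where w_cont: "continuous_on UNIV w" and w_le: "\<And>s. norm (w s) \<le> MU / \<gamma>1"
    and w_deriv: "\<And>s. s < 0 \<Longrightarrow>
      (w has_vector_derivative A *v w s + U (w s + p (s + t)) v0) (at_right s)"
    and w0: "w 0 = critical_F A U \<zeta> (path_shift t \<omega>) v0"
  proof -
    have shift: "path_shift r (path_shift t \<omega>) = path_shift (r + t) \<omega>" for r
      by (simp add: path_shift_def fun_eq_iff add.assoc)
    have "path_shift t \<omega> \<in> \<Omega>'" using \<omega> shift_\<Omega> by blast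
    then have "cadlag (\<lambda>r. \<zeta> (path_shift r (path_shift t \<omega>)))"
      using zeta by (simp add: stationary_solution_def)
    then have "continuous (at_right r) (\<lambda>r. \<zeta> (path_shift r (path_shift t \<omega>)))" for r
      by (simp add: cadlag_def continuous_within)
    moreover have "norm (U x v0 - U x' v0) \<le> L * norm (x - x')" for x x'
      using H3(2)[of x v0 x' v0] by simp
    ultimately show thesis
      using A.critical_F_trajectory[of L U v0 MU \<zeta> "path_shift t \<omega>"] H3(1) H4 U_le that
      unfolding shift p_def by auto
  qed

  \<comment> \<open>On \<open>{0..t}\<close> the frozen trajectory and \<open>x\<close> see the same noise, and their forcings differ by
    at most \<open>L\<close> times the sum of their distance and the slow displacement.\<close>
  have fast: "norm (x t - w 0) \<le> exp (- (\<gamma>1 - L) * t) * norm (x 0 - w (0 - t))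
    + L * D t / (\<gamma>1 - L) * (1 - exp (- (\<gamma>1 - L) * t))"
  proof -
    have "norm (x t - w (t - t)) \<le> exp (- (\<gamma>1 - L) * t) * norm (x 0 - w (0 - t))
      + L * D t / (\<gamma>1 - L) * (1 - exp (- (\<gamma>1 - L) * t))"
    proof (rule A.norm_le_comparison[OF t,
          where h = "\<lambda>r. U (x r + p r) (v r) - U (w (r - t) + p r) v0"])
      show "continuous_on {0..t} (\<lambda>r. x r - w (r - t))"
        by (intro continuous_intros integral_equation_continuous[OF x_int]
            continuous_on_compose2[OF w_cont]) auto
    next
      fix r assume r: "0 \<le> r" "r < t"
      have "((\<lambda>r. r - t) has_real_derivative 1) (at_right r)"
        by (auto intro!: derivative_eq_intros)
      moreover have "(\<lambda>r. r - t) ` {r<..} = {r - t<..}"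
        by (auto simp: image_iff intro!: bexI[of _ "_ + t"])
      ultimately have "(w \<circ> (\<lambda>r. r - t) has_vector_derivative
          1 *\<^sub>R (A *v w (r - t) + U (w (r - t) + p (r - t + t)) v0)) (at_right r)"
        using w_deriv[of "r - t"] r
        by (intro vector_diff_chain_within)
          (simp_all add: has_real_derivative_iff_has_vector_derivative)
      then have "((\<lambda>r. w (r - t)) has_vector_derivative
          A *v w (r - t) + U (w (r - t) + p r) v0) (at_right r)"
        by (simp add: o_def)
      from has_vector_derivative_diff[OF x_deriv[OF r(1)] this]
      show "((\<lambda>r. x r - w (r - t)) has_vector_derivative
          A *v (x r - w (r - t)) + (U (x r + p r) (v r) - U (w (r - t) + p r) v0)) (at_right r)"
        by (simp add: matrix_vector_mult_diff_distrib algebra_simps)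
      have "norm (U (x r + p r) (v r) - U (w (r - t) + p r) v0)
          \<le> L * (norm ((x r + p r) - (w (r - t) + p r)) + norm (v r - v0))"
        by (rule H3(2))
      also have "\<dots> \<le> L * (norm (x r - w (r - t)) + D t)"
        using slow[of r] D_mono[of r t] r H3(1) by (intro mult_left_mono) auto
      finally show "norm (U (x r + p r) (v r) - U (w (r - t) + p r) v0)
          \<le> L * norm (x r - w (r - t)) + L * D t" by (simp add: distrib_left)
    qed (use H3(1) H4 D_mono[OF t] D0 in auto)
    then show ?thesis by simp
  qed

  let ?c = "1 - (a + b)"
  let ?P = "norm (u0 - \<zeta> \<omega>) + MU / \<gamma>1"
  let ?Q = "2 * norm (u0 - \<zeta> \<omega>) + 2 * (MU / \<gamma>1) + MV / \<gamma>2"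
  have D_nonneg: "0 \<le> D t" using D_mono[OF t] D0 by simp
  have "sum_norm (z t - reduced_process A U \<zeta> \<omega> v0 t) = norm (x t - w 0) + norm (v t - v0)"
    by (simp add: sum_norm_def reduced_process_def w0 x_def v_def p_def algebra_simps)
  also have "\<dots> \<le> exp (- \<mu> * t) / ?c * ?Q + L / (\<gamma>1 - L) * D t + D t"
  proof -
    have "exp (- (\<gamma>1 - L) * t) * norm (x 0 - w (0 - t)) \<le> exp (- \<mu> * t) * ?P"
    proof (rule mult_mono)
      show "exp (- (\<gamma>1 - L) * t) \<le> exp (- \<mu> * t)"
        using mult_right_mono[of \<mu> "\<gamma>1 - L" t] mu t by (simp add: algebra_simps)
      show "norm (x 0 - w (0 - t)) \<le> ?P"
        using norm_triangle_ineq4[of "x 0" "w (0 - t)"] w_le[of "0 - t"] x0 by simp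
    qed auto
    also have "\<dots> \<le> exp (- \<mu> * t) * (?Q / ?c)"
    proof (rule mult_left_mono)
      have "0 \<le> MU / \<gamma>1" "0 \<le> MV / \<gamma>2" using MU MV H1(1) H2(1) by simp_all
      then have Q: "0 \<le> ?Q" "?P \<le> ?Q" using norm_ge_zero[of "u0 - \<zeta> \<omega>"] by linarith+
      have "?Q * ?c \<le> ?Q * 1" using Q a b by (intro mult_left_mono) auto
      then have "?Q \<le> ?Q / ?c" using eps(2) by (simp add: pos_le_divide_eq)
      with Q show "?P \<le> ?Q / ?c" by linarith
    qed simp
    finally have 1: "exp (- (\<gamma>1 - L) * t) * norm (x 0 - w (0 - t)) \<le> exp (- \<mu> * t) / ?c * ?Q"
      by simp
    have "L * D t / (\<gamma>1 - L) * (1 - exp (- (\<gamma>1 - L) * t)) \<le> L * D t / (\<gamma>1 - L) * 1"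
      using D_nonneg H3(1) H4 by (intro mult_left_mono) auto
    then show ?thesis using 1 fast slow[OF t] by simp
  qed
  also have "\<dots> = exp (- \<mu> * t) / ?c * ?Q + (1 + L / (\<gamma>1 - L)) * D t"
    by (simp add: algebra_simps)
  also have "\<dots> \<le> exp (- \<mu> * t) / ?c * ?Q + (1 - b) / ?c * D t"
    using slow_coefficient_le[of L \<mu> \<gamma>1 b] H3(1) mu b eps(2)
    by (intro add_left_mono mult_right_mono D_nonneg) (simp add: a_def)
  also have "\<dots> \<le> exp (- \<mu> * t) / ?c * ?Q + (1 - b) / ?c * D t + 1 * err_beta \<gamma>1 \<gamma>2 \<mu> \<epsilon>"
    using err_beta_nonneg[of \<epsilon> \<gamma>2 \<mu> \<gamma>1] \<epsilon>(1) H2(1) eps(1) mu H3(1) by simp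
  finally show "sum_norm (z t - reduced_process A U \<zeta> \<omega> v0 t)
      \<le> exp (- \<mu> * t) / (1 - (L / (\<gamma>1 - \<mu>) + \<epsilon> * L / (\<mu> - \<epsilon> * \<gamma>2)))
           * (2 * norm (u0 - \<zeta> \<omega>) + 2 * (MU / \<gamma>1) + MV / \<gamma>2)
        + (1 - \<epsilon> * L / (\<mu> - \<epsilon> * \<gamma>2)) / (1 - (L / (\<gamma>1 - \<mu>) + \<epsilon> * L / (\<mu> - \<epsilon> * \<gamma>2)))
           * ((norm (B *v v0) + MV) / \<gamma>3) * (1 - exp (- \<epsilon> * \<gamma>3 * t))
        + 1 * err_beta \<gamma>1 \<gamma>2 \<mu> \<epsilon>"
    by (simp only: a_def b_def D_def K_def mult.assoc)
qed simp

end
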